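(* Let $E$ be a Banach space with normalized Schauder basis $(e_n)_n$ and let $(\mathcal{D}_E,\mathcal{A}_E)$ be an admissible system of blocks for $E$. Then $E$ contains a $\mathcal{D}_E$-block subspace which is either $\mathcal{A}_E$-tight or $\mathcal{A}_E$-minimal.
   Context: Conventions. Banach spaces are separable, infinite dimensional (real). $\mathbb{N}=\omega=\{0,1,2,\dots\}$; $[\mathbb{N}]^{\infty}$, $[\mathbb{N}]^{<\infty}$ are the sets of infinite, finite subsets of $\mathbb{N}$. $[x_n]_n$ is the closed linear span. Given the basis $(e_n)_n$ of $E$, $\mathrm{supp}_E(x)=\{n: e_n^*(x)\neq 0\}$, and $x<y$ means $\max \mathrm{supp}_E(x)<\min\mathrm{supp}_E(y)$. A block basis of $(e_n)_n$ is a sequence $(x_n)_n$ of nonzero finitely supported vectors with $x_n<x_{n+1}$ for all $n$; if $X=[x_n]_n$, $\mathrm{supp}_X(u)$ is the support of $u\in X$ with respect to the basis $(x_n)_n$. For $K\ge 1$, $(x_n)_n\sim_K (y_n)_n$ means $\frac1K\|\sum_{n\le k}a_nx_n\|\le\|\sum_{n\le k}a_ny_n\|\le K\|\sum_{n\le k}a_nx_n\|$ for all $k$ and all scalars $a_0,\dots,a_k$; $\sim$ means $\sim_K$ for some $K\geq 1$. Intervals are sets $[a,b]\cap\mathbb{N}$ with $0\le a<b$; a sequence of intervals $(I_i)_i$ is successive if $\max I_i<\min I_{i+1}$ for all $i$. Fix a countable subfield $\mathbf{F}_E\subseteq\mathbb{R}$ containing $\mathbb{Q}$ such that every finite $\mathbf{F}_E$-linear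 combination of $(e_n)_n$ has norm in $\mathbf{F}_E$; $\mathbb{D}_E$ is the (countable) set of nonzero finite $\mathbf{F}_E$-linear combinations of $(e_n)_n$. Operation $\ast_X$. Let $X=[x_n]_n$ with $(x_n)_n$ a sequence of successive finitely supported vectors. For $u=(u_n)_n\in(\mathbb{D}_E\cap X)^\omega$ with $u_n=\sum_{i\in \mathrm{supp}_X(u_n)}\lambda_i^n x_i$ and $v=(v_n)_n\in(\mathbb{D}_E)^\omega$, $u\ast_X v$ is the sequence $(w_n)_n$ with $w_n=\sum_{i\in\mathrm{supp}_X(u_n)}\lambda_i^n v_i$. Set of blocks. $\mathcal{D}_E$ is a set of blocks for $E$ if: (a) $\mathcal{D}_E\subseteq\mathbb{D}_E$; (b) $e_n\in\mathcal{D}_E$ for all $n$; (c) $u\in\mathcal{D}_E\Rightarrow u/\|u\|\in\mathcal{D}_E$; (d) $u,v\in(\mathcal{D}_E)^\omega\Rightarrow u\ast_E v\in(\mathcal{D}_E)^\omega$; (e) if $x_0<x_1<\dots<x_n$ are in $\mathcal{D}_E$ and $\sum_{i\le n}\lambda_i x_i\in\mathcal{D}_E$, then $\sum_{i\le n}\lambda_i e_i\in\mathcal{D}_E$. Block subspaces. A $\mathcal{D}_E$-block sequence is a block basis of $(e_n)_n$ all of whose terms lie in $\mathcal{D}_E$. A $\mathcal{D}_E$-block subspace is the closed span $X=[x_n]_n$ of a normalized $\mathcal{D}_E$-block sequence $(x_n)_n$, which is its fixed basis. For such $X$, $\mathcal{D}_X:=\mathcal{D}_E\cap X$; a $\mathcal{D}_X$-block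 sequence is a block basis of $(e_n)_n$ with all terms in $\mathcal{D}_X$, and a $\mathcal{D}_X$-block subspace is the closed span of a normalized one. Admissible set. With $\mathcal{D}_E$ discrete and $(\mathcal{D}_E)^\omega$ carrying the product topology, $\mathcal{A}_E$ is an admissible set for $E$ (relative to $\mathcal{D}_E$) if: (a) $\mathcal{A}_E$ is a closed subset of $(\mathcal{D}_E)^\omega$; (b) it contains all $\mathcal{D}_E$-block sequences; (c) for every $(y_n)_n\in\mathcal{A}_E$, every $\mathcal{D}_E$-block subspace $X=[x_n]_n$ and every $(u_n)_n\in(\mathcal{D}_X)^\omega$: $(u_n)_n\in\mathcal{A}_E\iff (u_n)_n\ast_X(y_n)_n\in\mathcal{A}_E$; (d) for every $\mathcal{D}_E$-block sequence $(y_n)_n$ with $Y=[y_n]_n$, every $(u_n)_n\in\mathcal{A}_E$ and $k\in\mathbb{N}$ there is $(v_n)_n\in Y^\omega$ with $(u_0,\dots,u_k,v_0,v_1,\dots)\in\mathcal{A}_E$. Put $\mathcal{A}_X:=\mathcal{A}_E\cap X^\omega$. Admissible system of blocks. $(\mathcal{D}_E,\mathcal{A}_E)$, with $\mathcal{D}_E$ a set of blocks and $\mathcal{A}_E$ an admissible set for $E$, is an admissible system of blocks for $E$ if for every $\mathcal{D}_E$-block subspace $X$, every sequence $(\delta_n)_n$ with $0<\delta_n<1$ and every $K\ge1$ there are nonempty sets $A_n\subseteq\mathcal{D}_X$ ($n\in\mathbb{N}$) such that: (a) for each $n$ and each $d\in[\mathbb{N}]^{<\infty}$ for which some $w\in\mathcal{D}_X$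 has $\mathrm{supp}_X(w)=d$, only finitely many $u\in A_n$ have $\mathrm{supp}_X(u)=d$; (b) for every $(w_i)_i\in\mathcal{A}_X$ with $1/K\le\|w_i\|\le K$ for all $i$ there is $(u_i)_i\in\mathcal{A}_X$ with, for each $n$, $u_n\in A_n$, $\mathrm{supp}_X(u_n)\subseteq\mathrm{supp}_X(w_n)$ and $\|w_n-u_n\|<\delta_n$. Embedding. For a Banach space $Y$ with normalized basis $(y_n)_n$ and $X$ either a $\mathcal{D}_E$-block subspace or the closed span $[x_n:n\in B]$, $B\subseteq\mathbb{N}$, of some of the terms of a normalized $\mathcal{D}_E$-block sequence $(x_n)_n$, $Y$ $\mathcal{A}$-embeds in $X$, written $Y\overset{\mathcal{A}}{\hookrightarrow}X$, if some $(u_n)_n\in\mathcal{A}_E\cap X^\omega$ satisfies $(u_n)_n\sim(y_n)_n$. Minimality. A $\mathcal{D}_E$-block subspace $X$ is $\mathcal{A}_E$-minimal if $X\overset{\mathcal{A}}{\hookrightarrow}Y$ for every $\mathcal{D}_X$-block subspace $Y$ of $X$. Tightness. Let $X=[x_n]_n$ be a $\mathcal{D}_E$-block subspace. A Banach space $Y$ with normalized basis is $\mathcal{A}_E$-tight in $(x_n)_n$ if there is a sequence of successive intervals $(I_i)_i$ such that for every $A\in[\mathbb{N}]^\infty$, $Y$ does not $\mathcal{A}$-embed in $[x_n:n\notin\bigcup_{i\in A}I_i]$. $X$ (equivalently its basis $(x_n)_n$) is $\mathcal{A}_E$-tight if every $\mathcal{D}_X$-block subspace $Y$ of $X$ is $\mathcal{A}_E$-tight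 in $(x_n)_n$. *)

theory Defs
  imports "HOL-Analysis.Analysis"
begin

text \<open>
  The Banach space \<open>E\<close> is the whole type \<open>'a :: banach\<close>, and \<open>e\<close> is its basis.  Separability and
  infinite dimension are consequences of the existence of a Schauder basis.  A subspace that comes
  with a fixed basis is represented by that basis \<open>x :: nat \<Rightarrow> 'a\<close>; as a set it is
  \<open>closed_span (range x)\<close>.
\<close>

definition schauder_basis :: "(nat \<Rightarrow> 'a::real_normed_vector) \<Rightarrow> bool" where
  "schauder_basis e \<longleftrightarrow> (\<forall>x. \<exists>!a :: nat \<Rightarrow> real. (\<lambda>n. a n *\<^sub>R e n) sums x)"

definition normalized :: "(nat \<Rightarrow> 'a::real_normed_vector) \<Rightarrow> bool" where
  "normalized x \<longleftrightarrow> (\<forall>n. norm (x n) = 1)"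

definition closed_span :: "'a::real_normed_vector set \<Rightarrow> 'a set" where
  "closed_span S = closure (span S)"

text \<open>Coordinates and support of \<open>u\<close> with respect to \<open>b\<close>.  They are only meaningful if \<open>b\<close> is a
  Schauder basis of \<open>closed_span (range b)\<close> and \<open>u\<close> belongs to that space.\<close>

definition coords :: "(nat \<Rightarrow> 'a::real_normed_vector) \<Rightarrow> 'a \<Rightarrow> nat \<Rightarrow> real" where
  "coords b u = (THE a. (\<lambda>n. a n *\<^sub>R b n) sums u)"

definition supp :: "(nat \<Rightarrow> 'a::real_normed_vector) \<Rightarrow> 'a \<Rightarrow> nat set" where
  "supp b u = {n. coords b u n \<noteq> 0}"

text \<open>For nonzero finitely supported \<open>x\<close> and \<open>y\<close> this says \<open>max (supp x) < min (supp y)\<close>.\<close>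

definition before :: "(nat \<Rightarrow> 'a::real_normed_vector) \<Rightarrow> 'a \<Rightarrow> 'a \<Rightarrow> bool" where
  "before e x y \<longleftrightarrow> (\<forall>i\<in>supp e x. \<forall>j\<in>supp e y. i < j)"

definition block_basis :: "(nat \<Rightarrow> 'a::real_normed_vector) \<Rightarrow> (nat \<Rightarrow> 'a) \<Rightarrow> bool" where
  "block_basis e x \<longleftrightarrow>
     (\<forall>n. x n \<noteq> 0 \<and> finite (supp e (x n))) \<and> (\<forall>n. before e (x n) (x (Suc n)))"

definition equiv_const ::
    "real \<Rightarrow> (nat \<Rightarrow> 'a::real_normed_vector) \<Rightarrow> (nat \<Rightarrow> 'b::real_normed_vector) \<Rightarrow> bool" where
  "equiv_const K x y \<longleftrightarrow>
     (\<forall>k (a :: nat \<Rightarrow> real).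
        1 / K * norm (\<Sum>n\<le>k. a n *\<^sub>R x n) \<le> norm (\<Sum>n\<le>k. a n *\<^sub>R y n) \<and>
        norm (\<Sum>n\<le>k. a n *\<^sub>R y n) \<le> K * norm (\<Sum>n\<le>k. a n *\<^sub>R x n))"

definition equivalent_seqs ::
    "(nat \<Rightarrow> 'a::real_normed_vector) \<Rightarrow> (nat \<Rightarrow> 'b::real_normed_vector) \<Rightarrow> bool" where
  "equivalent_seqs x y \<longleftrightarrow> (\<exists>K\<ge>1. equiv_const K x y)"

definition successive_intervals :: "(nat \<Rightarrow> nat set) \<Rightarrow> bool" where
  "successive_intervals I \<longleftrightarrow>
     (\<forall>i. \<exists>a b. a < b \<and> I i = {a..b}) \<and> (\<forall>i. Max (I i) < Min (I (Suc i)))"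

definition real_subfield :: "real set \<Rightarrow> bool" where
  "real_subfield F \<longleftrightarrow>
     0 \<in> F \<and> 1 \<in> F \<and>
     (\<forall>a\<in>F. \<forall>b\<in>F. a + b \<in> F \<and> a * b \<in> F) \<and>
     (\<forall>a\<in>F. - a \<in> F \<and> inverse a \<in> F)"

definition scalar_field :: "(nat \<Rightarrow> 'a::real_normed_vector) \<Rightarrow> real set \<Rightarrow> bool" where
  "scalar_field e F \<longleftrightarrow>
     real_subfield F \<and> countable F \<and> \<rat> \<subseteq> F \<and>
     (\<forall>S a. finite S \<longrightarrow> (\<forall>n\<in>S. a n \<in> F) \<longrightarrow> norm (\<Sum>n\<in>S. a n *\<^sub>R e n) \<in> F)"

definition rational_vectors :: "(nat \<Rightarrow> 'a::real_normed_vector) \<Rightarrow> real set \<Rightarrow> 'a set" where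
  "rational_vectors e F =
     {x. x \<noteq> 0 \<and> (\<exists>S a. finite S \<and> (\<forall>n\<in>S. a n \<in> F) \<and> x = (\<Sum>n\<in>S. a n *\<^sub>R e n))}"

text \<open>\<open>star x u v\<close> is \<open>u \<ast>\<^sub>X v\<close> for the space \<open>X\<close> with fixed basis \<open>x\<close>.\<close>

definition star ::
    "(nat \<Rightarrow> 'a::real_normed_vector) \<Rightarrow> (nat \<Rightarrow> 'a) \<Rightarrow> (nat \<Rightarrow> 'a) \<Rightarrow> nat \<Rightarrow> 'a" where
  "star x u v = (\<lambda>n. \<Sum>i\<in>supp x (u n). coords x (u n) i *\<^sub>R v i)"

text \<open>In the closure condition under \<open>star e\<close> the sequence \<open>v\<close> need not be a block sequence.  As \<open>D\<close>
  consists of nonzero vectors, the condition also says that no term of \<open>star e u v\<close> vanishes.\<close>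

definition set_of_blocks ::
    "(nat \<Rightarrow> 'a::real_normed_vector) \<Rightarrow> real set \<Rightarrow> 'a set \<Rightarrow> bool" where
  "set_of_blocks e F D \<longleftrightarrow>
     D \<subseteq> rational_vectors e F \<and>
     (\<forall>n. e n \<in> D) \<and>
     (\<forall>u\<in>D. u /\<^sub>R norm u \<in> D) \<and>
     (\<forall>u v. (\<forall>n. u n \<in> D) \<longrightarrow> (\<forall>n. v n \<in> D) \<longrightarrow> (\<forall>n. star e u v n \<in> D)) \<and>
     (\<forall>n (x :: nat \<Rightarrow> 'a) (c :: nat \<Rightarrow> real).
        (\<forall>i\<le>n. x i \<in> D) \<longrightarrow> (\<forall>i<n. before e (x i) (x (Suc i))) \<longrightarrow>
        (\<Sum>i\<le>n. c i *\<^sub>R x i) \<in> D \<longrightarrow> (\<Sum>i\<le>n. c i *\<^sub>R e i) \<in> D)"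

text \<open>The set \<open>D\<close> below is \<open>\<D>\<^sub>E\<close>, or \<open>\<D>\<^sub>X = \<D>\<^sub>E \<inter> X\<close> for a block subspace \<open>X\<close>; blocks are always
  taken with respect to the basis \<open>e\<close> of \<open>E\<close>.\<close>

definition block_seq ::
    "(nat \<Rightarrow> 'a::real_normed_vector) \<Rightarrow> 'a set \<Rightarrow> (nat \<Rightarrow> 'a) \<Rightarrow> bool" where
  "block_seq e D x \<longleftrightarrow> block_basis e x \<and> (\<forall>n. x n \<in> D)"

definition block_subspace ::
    "(nat \<Rightarrow> 'a::real_normed_vector) \<Rightarrow> 'a set \<Rightarrow> (nat \<Rightarrow> 'a) \<Rightarrow> bool" where
  "block_subspace e D x \<longleftrightarrow> block_seq e D x \<and> normalized x"

definition blocks_in :: "'a::real_normed_vector set \<Rightarrow> (nat \<Rightarrow> 'a) \<Rightarrow> 'a set" where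
  "blocks_in D x = D \<inter> closed_span (range x)"

definition admissible_set ::
    "(nat \<Rightarrow> 'a::real_normed_vector) \<Rightarrow> 'a set \<Rightarrow> (nat \<Rightarrow> 'a) set \<Rightarrow> bool" where
  "admissible_set e D A \<longleftrightarrow>
     closedin (product_topology (\<lambda>_. discrete_topology D) UNIV) A \<and>
     (\<forall>x. block_seq e D x \<longrightarrow> x \<in> A) \<and>
     (\<forall>y\<in>A. \<forall>x u. block_subspace e D x \<longrightarrow> (\<forall>n. u n \<in> blocks_in D x) \<longrightarrow>
        (u \<in> A \<longleftrightarrow> star x u y \<in> A)) \<and>
     (\<forall>y u k. block_seq e D y \<longrightarrow> u \<in> A \<longrightarrow>
        (\<exists>v. (\<forall>n. v n \<in> closed_span (range y)) \<and>
             (\<lambda>i. if i \<le> k then u i else v (i - Suc k)) \<in> A))"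

definition seqs_in ::
    "(nat \<Rightarrow> 'a::real_normed_vector) set \<Rightarrow> 'a set \<Rightarrow> (nat \<Rightarrow> 'a) set" where
  "seqs_in A Z = {u \<in> A. \<forall>n. u n \<in> Z}"

definition admissible_system ::
    "(nat \<Rightarrow> 'a::real_normed_vector) \<Rightarrow> real set \<Rightarrow> 'a set \<Rightarrow> (nat \<Rightarrow> 'a) set \<Rightarrow> bool" where
  "admissible_system e F D A \<longleftrightarrow>
     set_of_blocks e F D \<and> admissible_set e D A \<and>
     (\<forall>x (\<delta> :: nat \<Rightarrow> real) (K :: real).
        block_subspace e D x \<longrightarrow> (\<forall>n. 0 < \<delta> n \<and> \<delta> n < 1) \<longrightarrow> K \<ge> 1 \<longrightarrow>
        (\<exists>B :: nat \<Rightarrow> 'a set.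
           (\<forall>n. B n \<noteq> {} \<and> B n \<subseteq> blocks_in D x) \<and>
           (\<forall>n d. finite d \<longrightarrow> (\<exists>w\<in>blocks_in D x. supp x w = d) \<longrightarrow>
              finite {u \<in> B n. supp x u = d}) \<and>
           (\<forall>w \<in> seqs_in A (closed_span (range x)).
              (\<forall>i. 1 / K \<le> norm (w i) \<and> norm (w i) \<le> K) \<longrightarrow>
              (\<exists>u \<in> seqs_in A (closed_span (range x)).
                 \<forall>n. u n \<in> B n \<and> supp x (u n) \<subseteq> supp x (w n) \<and> norm (w n - u n) < \<delta> n))))"

text \<open>\<open>A_embeds A y Z\<close>: the space with basis \<open>y\<close> \<open>\<A>\<close>-embeds in the closed subspace \<open>Z\<close> of \<open>E\<close>.\<close>

definition A_embeds ::
    "(nat \<Rightarrow> 'a::real_normed_vector) set \<Rightarrow> (nat \<Rightarrow> 'b::real_normed_vector) \<Rightarrow> 'a set \<Rightarrow> bool" where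
  "A_embeds A y Z \<longleftrightarrow> (\<exists>u \<in> seqs_in A Z. equivalent_seqs u y)"

definition A_minimal ::
    "(nat \<Rightarrow> 'a::real_normed_vector) \<Rightarrow> 'a set \<Rightarrow> (nat \<Rightarrow> 'a) set \<Rightarrow> (nat \<Rightarrow> 'a) \<Rightarrow> bool" where
  "A_minimal e D A x \<longleftrightarrow>
     (\<forall>y. block_subspace e (blocks_in D x) y \<longrightarrow> A_embeds A x (closed_span (range y)))"

definition A_tight_in ::
    "(nat \<Rightarrow> 'a::real_normed_vector) set \<Rightarrow> (nat \<Rightarrow> 'b::real_normed_vector) \<Rightarrow> (nat \<Rightarrow> 'a) \<Rightarrow> bool"
  where
  "A_tight_in A y x \<longleftrightarrow>
     (\<exists>I. successive_intervals I \<and>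
        (\<forall>M :: nat set. infinite M \<longrightarrow> \<not> A_embeds A y (closed_span (x ` {n. n \<notin> (\<Union>i\<in>M. I i)}))))"

definition A_tight ::
    "(nat \<Rightarrow> 'a::real_normed_vector) \<Rightarrow> 'a set \<Rightarrow> (nat \<Rightarrow> 'a) set \<Rightarrow> (nat \<Rightarrow> 'a) \<Rightarrow> bool" where
  "A_tight e D A x \<longleftrightarrow> (\<forall>y. block_subspace e (blocks_in D x) y \<longrightarrow> A_tight_in A y x)"

end

theory Submission
  imports Defs
begin

text \<open>
  The argument follows Ferenczi and Rosendal.  In an asymptotic game for a block sequence \<open>y\<close> in a
  block subspace \<open>Z\<close>, player I plays numbers \<open>n\<close>, and player II, who may use only blocks of \<open>Z\<close>
  beyond these numbers, builds an admissible sequence equivalent to \<open>y\<close> with a fixed constant.  Since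
  the payoff is closed for II, one of the players wins.

  If some block subspace \<open>X\<close> is such that I wins for all constants and all block sequences of \<open>X\<close>, then
  \<open>X\<close> is tight: the nets of an admissible system leave finitely many positions to consider up to each
  coordinate, and the intervals are chosen so long that an embedding which avoids infinitely many of
  them would be a winning run for II against I's strategy.

  Otherwise a fusion argument yields a constant \<open>C\<close> and an \<open>X\<close> such that every \<open>Z \<le>\<^sup>* X\<close> has a block subspace
  \<open>Y\<close> for which II wins in \<open>Z\<close>.  Hence II can copy in \<open>Z\<close> whatever I builds in \<open>Y\<close>.  Stabilising the
  countably many positions of this copying game makes \<open>Y\<close> independent of \<open>Z\<close>, except that I must now
  play beyond numbers chosen by II.  But II can meet such demands in the asymptotic game for some
  \<open>Y \<le>\<^sup>* X\<close> in \<open>X\<close>, and composing the two games embeds \<open>Y\<close> in every \<open>Z \<le>\<^sup>* X\<close>.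
\<close>

subsection \<open>Closed spans, equivalence and initial segments\<close>

lemma closed_span_superset: "S \<subseteq> closed_span S"
  unfolding closed_span_def using closure_subset span_superset by blast

lemma closed_span_minimal:
  assumes "S \<subseteq> T" "subspace T" "closed T"
  shows "closed_span S \<subseteq> T"
  unfolding closed_span_def by (meson assms closure_minimal span_minimal)

lemma subspace_closure_span: "subspace (closure (span S))"
  for S :: "'a::real_normed_vector set"
proof (rule subspaceI)
  show "0 \<in> closure (span S)"
    using closure_subset span_zero by blast
next
  fix x y assume "x \<in> closure (span S)" "y \<in> closure (span S)"
  then obtain f g where "\<And>n. f n \<in> span S" "f \<longlonglongrightarrow> x" "\<And>n. g n \<in> span S" "g \<longlonglongrightarrow> y"
    by (meson closure_sequential)
  then show "x + y \<in> closure (span S)"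
    unfolding closure_sequential by (intro exI[of _ "\<lambda>n. f n + g n"]) (simp add: span_add tendsto_add)
next
  fix c x assume "x \<in> closure (span S)"
  then obtain f where "\<And>n. f n \<in> span S" "f \<longlonglongrightarrow> x"
    by (meson closure_sequential)
  then show "c *\<^sub>R x \<in> closure (span S)"
    unfolding closure_sequential by (intro exI[of _ "\<lambda>n. c *\<^sub>R f n"]) (simp add: span_scale tendsto_scaleR)
qed

lemma subspace_closed_span: "subspace (closed_span S)"
  unfolding closed_span_def by (rule subspace_closure_span)

lemma closed_span_mono: "S \<subseteq> T \<Longrightarrow> closed_span S \<subseteq> closed_span T"
  unfolding closed_span_def by (intro closure_mono span_mono)

lemma span_subset_closed_span: "S \<subseteq> closed_span T \<Longrightarrow> span S \<subseteq> closed_span T"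
  by (simp add: span_minimal subspace_closed_span)

lemma bounded_linear_eq_on_closed_span:
  assumes "bounded_linear f" "bounded_linear g" "\<And>v. v \<in> S \<Longrightarrow> f v = g v" "u \<in> closed_span S"
  shows "f u = g u"
proof -
  have "closed_span S \<subseteq> {u. f u = g u}"
  proof (rule closed_span_minimal)
    show "subspace {u. f u = g u}"
      using assms by (simp add: subspace_def linear_simps)
    show "closed {u. f u = g u}"
      using assms by (intro closed_Collect_eq) (auto simp: linear_continuous_on)
  qed (use assms in auto)
  then show ?thesis
    using assms by auto
qed

text \<open>A finite form of \<open>equiv_const\<close> that can be tested at a position of a game.
  Both inequalities are written with products, so that constants compose for all nonnegative
  \<open>K\<close>.\<close>

definition equiv_upto :: "real \<Rightarrow> nat \<Rightarrow> (nat \<Rightarrow> 'a::real_normed_vector) \<Rightarrow> (nat \<Rightarrow> 'b::real_normed_vector) \<Rightarrow> bool" where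
  "equiv_upto K k x y \<longleftrightarrow>
     (\<forall>a :: nat \<Rightarrow> real.
        norm (\<Sum>n<k. a n *\<^sub>R x n) \<le> K * norm (\<Sum>n<k. a n *\<^sub>R y n) \<and>
        norm (\<Sum>n<k. a n *\<^sub>R y n) \<le> K * norm (\<Sum>n<k. a n *\<^sub>R x n))"

lemma equiv_const_iff_upto:
  assumes "K > 0"
  shows "equiv_const K x y \<longleftrightarrow> (\<forall>k. equiv_upto K k x y)"
proof -
  have "equiv_upto K 0 x y"
    by (simp add: equiv_upto_def)
  then have "(\<forall>k. equiv_upto K k x y) \<longleftrightarrow> (\<forall>k. equiv_upto K (Suc k) x y)"
    by (metis not0_implies_Suc)
  then show ?thesis
    using assms unfolding equiv_const_def equiv_upto_def
    by (simp only: lessThan_Suc_atMost) (simp add: field_simps)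
qed

lemma equiv_upto_trans:
  assumes "equiv_upto K k x y" "equiv_upto L k y z" "K \<ge> 0" "L \<ge> 0"
  shows "equiv_upto (K * L) k x z"
  unfolding equiv_upto_def
proof (intro allI conjI)
  fix a
  let ?s = "\<lambda>v. norm (\<Sum>n<k. a n *\<^sub>R v n)"
  have "?s x \<le> K * ?s y" "?s y \<le> K * ?s x" "?s y \<le> L * norm (\<Sum>n<k. a n *\<^sub>R z n)" "norm (\<Sum>n<k. a n *\<^sub>R z n) \<le> L * ?s y"
    using assms(1,2) by (auto simp: equiv_upto_def)
  then have "?s x \<le> K * (L * norm (\<Sum>n<k. a n *\<^sub>R z n))" "norm (\<Sum>n<k. a n *\<^sub>R z n) \<le> L * (K * ?s x)"
    using assms(3,4) by (meson mult_left_mono order_trans)+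
  then show "?s x \<le> K * L * norm (\<Sum>n<k. a n *\<^sub>R z n)" "norm (\<Sum>n<k. a n *\<^sub>R z n) \<le> K * L * ?s x"
    by (simp_all add: mult_ac)
qed

lemma equiv_upto_mono_const:
  assumes "equiv_upto K k x y" "K \<le> L"
  shows "equiv_upto L k x y"
  using assms unfolding equiv_upto_def by (meson mult_right_mono norm_ge_zero order_trans)

lemma equiv_upto_cong:
  assumes "equiv_upto K k x y" "\<And>i. i < k \<Longrightarrow> x' i = x i" "\<And>i. i < k \<Longrightarrow> y' i = y i"
  shows "equiv_upto K k x' y'"
  using assms by (simp add: equiv_upto_def)

lemma equiv_upto_norm:
  assumes "equiv_upto K (Suc n) x y" "norm (y n) = 1" "K \<ge> 1"
  shows "1 / K \<le> norm (x n)" "norm (x n) \<le> K"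
proof -
  have "norm (x n) \<le> K * norm (y n)" "norm (y n) \<le> K * norm (x n)"
    using assms(1)[unfolded equiv_upto_def, rule_format, of "\<lambda>i. if i = n then 1 else 0"] by simp_all
  then show "1 / K \<le> norm (x n)" "norm (x n) \<le> K"
    using assms by (simp_all add: field_simps)
qed

text \<open>The tree of the closed set \<open>A\<close>. Through it admissibility becomes a
  condition on finite positions.\<close>

definition initial_segment :: "(nat \<Rightarrow> 'a) set \<Rightarrow> 'a list \<Rightarrow> bool" where
  "initial_segment A us \<longleftrightarrow> (\<exists>v\<in>A. \<forall>i<length us. us ! i = v i)"

lemma initial_segmentI: "u \<in> A \<Longrightarrow> initial_segment A (map u [0..<k])"
  by (auto simp: initial_segment_def)

text \<open>The relation \<open>\<le>\<^sup>*\<close>. Finitely many terms are disregarded so that a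
  diagonal sequence can lie below every member of a decreasing sequence.\<close>

definition almost_sub :: "(nat \<Rightarrow> 'a::real_normed_vector) \<Rightarrow> (nat \<Rightarrow> 'a) \<Rightarrow> bool" where
  "almost_sub y x \<longleftrightarrow> (\<exists>N. \<forall>n\<ge>N. y n \<in> closed_span (range x))"

lemma almost_sub_refl: "almost_sub x x"
  unfolding almost_sub_def using closed_span_superset[of "range x"] by blast

subsection \<open>Schauder bases\<close>

locale normalized_schauder_basis =
  fixes e :: "nat \<Rightarrow> 'a::banach"
  assumes basis: "schauder_basis e" and normalized_basis: "normalized e"
begin

definition proj :: "nat \<Rightarrow> 'a \<Rightarrow> 'a" where
  "proj n x = (\<Sum>i<n. coords e x i *\<^sub>R e i)"

lemma norm_e [simp]: "norm (e n) = 1"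
  using normalized_basis by (simp add: normalized_def)

lemma coords_sums: "(\<lambda>n. coords e x n *\<^sub>R e n) sums x"
  using basis theI'[of "\<lambda>a. (\<lambda>n. a n *\<^sub>R e n) sums x"]
  unfolding schauder_basis_def coords_def by blast

lemma coords_unique:
  assumes "(\<lambda>n. a n *\<^sub>R e n) sums x"
  shows "coords e x = a"
  using basis assms coords_sums[of x] unfolding schauder_basis_def by blast

lemma coords_add: "coords e (x + y) n = coords e x n + coords e y n"
proof -
  have "(\<lambda>n. (coords e x n + coords e y n) *\<^sub>R e n) sums (x + y)"
    using sums_add[OF coords_sums[of x] coords_sums[of y]] by (simp add: scaleR_add_left)
  then show ?thesis
    using coords_unique by fastforce
qed

lemma coords_scaleR: "coords e (r *\<^sub>R x) n = r * coords e x n"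
proof -
  have "(\<lambda>n. (r * coords e x n) *\<^sub>R e n) sums (r *\<^sub>R x)"
    using bounded_linear.sums[OF bounded_linear_scaleR_right[of r] coords_sums[of x]] by simp
  then show ?thesis
    using coords_unique by fastforce
qed

lemma linear_coords: "linear (\<lambda>x. coords e x n)"
  by (rule linearI) (simp_all add: coords_add coords_scaleR)

lemma linear_proj: "linear (proj n)"
  unfolding proj_def
  by (rule linearI)
     (simp_all add: coords_add coords_scaleR scaleR_add_left sum.distrib scaleR_sum_right)

lemma proj_tendsto: "(\<lambda>n. proj n x) \<longlonglongrightarrow> x"
  using coords_sums[of x] by (simp add: sums_def proj_def)

section \<open>Uniform boundedness of the partial-sum projections\<close>

lemma proj_bounded: "\<exists>N::nat. \<forall>n. norm (proj n x) \<le> N"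
proof -
  have "Bseq (\<lambda>n. proj n x)"
    using proj_tendsto convergent_def convergent_imp_Bseq by blast
  then obtain K where "\<And>n. norm (proj n x) \<le> K"
    by (auto simp: Bseq_def)
  then show ?thesis
    by (meson order_trans real_arch_simple)
qed

text \<open>Baire: the closures of the sets \<open>B N\<close> cover the Banach space, so one of
  them contains a ball. Differences of two elements of \<open>B N\<close> then approximate every
  short vector, and scaling reaches all vectors.\<close>

lemma ex_bounded_approximation:
  "\<exists>L>0. \<forall>x. \<forall>\<epsilon>>0. \<exists>z. norm (x - z) < \<epsilon> \<and> (\<forall>n. norm (proj n z) \<le> L * norm x)"
proof -
  define B where "B N = {x. \<forall>n. norm (proj n x) \<le> real N}" for N :: nat
  have "(\<Union>N. closure (B N)) = UNIV"
  proof -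
    have "x \<in> (\<Union>N. B N)" for x
      using proj_bounded[of x] by (auto simp: B_def)
    then show ?thesis
      using closure_subset by fastforce
  qed
  moreover have "euclidean interior_of \<Union>(range (\<lambda>N. closure (B N))) = {}"
    if "\<And>N. interior (closure (B N)) = {}"
    by (rule Baire_category_alt) (use that in \<open>auto simp: completely_metrizable_space_euclidean\<close>)
  ultimately obtain N where "interior (closure (B N)) \<noteq> {}"
    by fastforce
  then obtain x0 r where r: "r > 0" "ball x0 r \<subseteq> closure (B N)"
    by (meson ex_in_conv mem_interior)
  have near: "\<exists>z. norm (x - z) < \<epsilon> \<and> (\<forall>n. norm (proj n z) \<le> 2 * real N)"
    if "norm x < r" "\<epsilon> > 0" for x \<epsilon>
  proof -
    have "x0 + x \<in> closure (B N)" "x0 \<in> closure (B N)"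
      using r that by (auto simp: subset_iff dist_norm)
    then obtain u v where u: "u \<in> B N" "dist u (x0 + x) < \<epsilon>/2" and v: "v \<in> B N" "dist v x0 < \<epsilon>/2"
      using \<open>\<epsilon> > 0\<close> by (meson closure_approachable half_gt_zero)
    have "norm (x - (u - v)) \<le> dist u (x0 + x) + dist v x0"
      using norm_triangle_ineq[of "x0 + x - u" "v - x0"] by (simp add: dist_norm norm_minus_commute algebra_simps)
    moreover have "norm (proj n (u - v)) \<le> 2 * real N" for n
    proof -
      have "norm (proj n u) \<le> N" "norm (proj n v) \<le> N"
        using u v by (auto simp: B_def)
      then show ?thesis
        using norm_triangle_ineq4[of "proj n u" "proj n v"] by (simp add: linear_diff[OF linear_proj])
    qed
    ultimately show ?thesis
      using u v by (intro exI[of _ "u - v"]) auto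
  qed
  show ?thesis
  \<comment> \<open>Rescaling by \<open>t = r / (2 * norm x)\<close> turns the bound
    \<open>2 * N\<close> into \<open>4 * N / r * norm x\<close>; the summand 1 keeps the constant
    positive when \<open>N = 0\<close>.\<close>
  proof (intro exI[of _ "4 * real N / r + 1"] conjI allI impI)
    show "0 < 4 * real N / r + 1"
      using r by (simp add: add_nonneg_pos)
    fix x :: 'a and \<epsilon> :: real
    assume "\<epsilon> > 0"
    show "\<exists>z. norm (x - z) < \<epsilon> \<and> (\<forall>n. norm (proj n z) \<le> (4 * real N / r + 1) * norm x)"
    proof (cases "x = 0")
      case True
      then show ?thesis
        using \<open>\<epsilon> > 0\<close> by (intro exI[of _ 0]) (simp add: linear_0[OF linear_proj])
    next
      case False
      define t where "t = r / (2 * norm x)"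
      have t: "t > 0"
        using r False by (simp add: t_def)
      have "norm (t *\<^sub>R x) < r"
        using r False by (simp add: t_def)
      then obtain z where z: "norm (t *\<^sub>R x - z) < t * \<epsilon>" "\<And>n. norm (proj n z) \<le> 2 * real N"
        using near[of "t *\<^sub>R x" "t * \<epsilon>"] t \<open>\<epsilon> > 0\<close> by auto
      have "x - z /\<^sub>R t = (t *\<^sub>R x - z) /\<^sub>R t"
        using t by (simp add: scaleR_diff_right)
      then have "norm (x - z /\<^sub>R t) = norm (t *\<^sub>R x - z) / t"
        using t by (simp add: divide_inverse mult.commute)
      also have "\<dots> < \<epsilon>"
        using z t by (simp add: divide_less_eq mult.commute)
      finally have "norm (x - z /\<^sub>R t) < \<epsilon>" .
      moreover have "norm (proj n (z /\<^sub>R t)) \<le> (4 * real N / r + 1) * norm x" for n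
      proof -
        have "norm (proj n (z /\<^sub>R t)) = norm (proj n z) / t"
          using t by (simp add: linear_scale[OF linear_proj] divide_inverse mult.commute)
        also have "\<dots> \<le> 2 * real N / t"
          using z t by (simp add: divide_right_mono)
        also have "\<dots> = 4 * real N / r * norm x"
          using r False by (simp add: t_def)
        also have "\<dots> \<le> (4 * real N / r + 1) * norm x"
          by (rule mult_right_mono) simp_all
        finally show ?thesis .
      qed
      ultimately show ?thesis
        by blast
    qed
  qed
qed

lemma coord_le_proj: "\<bar>coords e z n\<bar> \<le> 2 * M" if "\<And>n. norm (proj n z) \<le> M"
proof -
  have "coords e z n *\<^sub>R e n = proj (Suc n) z - proj n z"
    by (simp add: proj_def)
  then have "\<bar>coords e z n\<bar> = norm (proj (Suc n) z - proj n z)"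
    by (metis norm_e norm_scaleR mult.right_neutral)
  also have "\<dots> \<le> norm (proj (Suc n) z) + norm (proj n z)"
    by (rule norm_triangle_ineq4)
  finally show ?thesis
    using that[of n] that[of "Suc n"] by linarith
qed

text \<open>Successive approximation as in the open mapping theorem.  The coordinates of the approximants
  are summed termwise, and Tannery's theorem shows that the sums are the coordinates of \<open>x\<close>.\<close>

theorem ex_basis_constant: "\<exists>c\<ge>1. \<forall>n x. norm (proj n x) \<le> c * norm x"
proof -
  obtain L where L: "L > 0"
    and approx: "\<And>x \<epsilon>. \<epsilon> > 0 \<Longrightarrow> \<exists>z. norm (x - z) < \<epsilon> \<and> (\<forall>n. norm (proj n z) \<le> L * norm x)"
    using ex_bounded_approximation by blast
  have "norm (proj n x) \<le> 2 * L * norm x" for n x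
  proof (cases "x = 0")
    case True
    then show ?thesis
      by (simp add: linear_0[OF linear_proj])
  next
    case False
    define a where "a k = norm x * (1/2)^k" for k :: nat
    have a: "a k > 0" for k
      using False by (simp add: a_def)
    have "\<exists>ap. \<forall>y k. norm (y - ap y k) < a (Suc k) \<and> (\<forall>n. norm (proj n (ap y k)) \<le> L * norm y)"
      using approx[OF a[of "Suc _"]] by metis
    then obtain ap where ap: "\<And>y k. norm (y - ap y k) < a (Suc k)"
        "\<And>y k n. norm (proj n (ap y k)) \<le> L * norm y"
      by blast
    define r where "r = rec_nat x (\<lambda>k y. y - ap y k)"
    define z where "z k = ap (r k) k" for k
    have r_simps: "r 0 = x" "r (Suc k) = r k - z k" for k
      by (simp_all add: r_def z_def)
    have norm_r: "norm (r k) \<le> a k" for k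
    proof (cases k)
      case 0
      then show ?thesis
        by (simp add: r_simps a_def)
    next
      case (Suc j)
      then show ?thesis
        using ap(1)[of "r j" j] by (simp add: r_simps z_def)
    qed
    have proj_z: "norm (proj n (z k)) \<le> L * a k" for n k
      using ap(2)[of n "r k" k] norm_r[of k] L by (simp add: z_def) (meson mult_left_mono order_less_imp_le order_trans)
    have norm_z: "norm (z k) \<le> L * a k" for k
      by (rule Lim_norm_ubound[OF _ proj_tendsto]) (simp_all add: proj_z)
    have a_sums: "a sums (2 * norm x)"
      using sums_mult[OF geometric_sums[of "1/2::real"], of "norm x"] by (simp add: a_def[abs_def] mult.commute)
    have sum_z: "(\<Sum>k<m. z k) = x - r m" for m
      by (induction m) (simp_all add: r_simps)
    have "a \<longlonglongrightarrow> 0"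
      using a_sums summable_LIMSEQ_zero sums_summable by blast
    then have "r \<longlonglongrightarrow> 0"
      by (intro Lim_null_comparison[of r a]) (simp_all add: norm_r)
    then have z_sums: "z sums x"
      using tendsto_diff[OF tendsto_const[of x], of r 0] by (simp add: sums_def sum_z)
    define \<alpha> where "\<alpha> n = (\<Sum>k. coords e (z k) n)" for n
    have summable_bound: "summable (\<lambda>k. 2 * (L * a k))"
      using a_sums by (intro summable_mult) (rule sums_summable)
    have \<alpha>: "(\<lambda>k. coords e (z k) n) sums \<alpha> n" for n
      unfolding \<alpha>_def
      by (rule summable_sums, rule summable_comparison_test[OF _ summable_bound])
         (use coord_le_proj[OF proj_z] in auto)
    define S where "S n = (\<Sum>i<n. \<alpha> i *\<^sub>R e i)" for n
    have S: "(\<lambda>k. proj n (z k)) sums S n" for n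
      unfolding S_def proj_def by (intro sums_sum bounded_linear.sums[OF bounded_linear_scaleR_left] \<alpha>)
    have diff_bound: "norm (proj n (z k) - z k) \<le> 2 * (L * a k)" for n k
      using norm_triangle_ineq4[of "proj n (z k)" "z k"] proj_z[of n k] norm_z[of k] by linarith
    have summable_diff: "summable (\<lambda>k. norm (proj n (z k) - z k))" for n
      by (rule summable_comparison_test[OF _ summable_bound]) (use diff_bound in auto)
    have "((\<lambda>n. \<Sum>k. norm (proj n (z k) - z k)) \<longlongrightarrow> (\<Sum>k::nat. 0)) sequentially"
    proof (rule tannerys_theorem[THEN conjunct2, THEN conjunct2, OF _ _ summable_bound])
      fix k
      show "(\<lambda>n. norm (proj n (z k) - z k)) \<longlonglongrightarrow> 0"
        using tendsto_norm_zero[OF LIM_zero[OF proj_tendsto]] .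
    qed (use diff_bound in \<open>auto simp: case_prod_unfold\<close>)
    then have lim: "(\<lambda>n. \<Sum>k. norm (proj n (z k) - z k)) \<longlonglongrightarrow> 0"
      by simp
    \<comment> \<open>\<open>S n - x\<close> is the sum over \<open>k\<close> of
      \<open>proj n (z k) - z k\<close>. Hence \<open>S\<close> converges to \<open>x\<close>, and
      uniqueness of expansions identifies \<open>coords e x\<close> with
      \<open>\<alpha>\<close>.\<close>
    have "norm (S n - x) \<le> (\<Sum>k. norm (proj n (z k) - z k))" for n
      using sums_diff[OF S[of n] z_sums] summable_norm[OF summable_diff[of n]] by (simp add: sums_iff)
    then have "(\<lambda>n. S n - x) \<longlonglongrightarrow> 0"
      by (intro Lim_null_comparison[OF _ lim]) simp
    then have "S \<longlonglongrightarrow> x"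
      by (rule LIM_zero_cancel)
    then have "coords e x = \<alpha>"
      by (intro coords_unique) (simp add: sums_def S_def[abs_def])
    then have "proj n x = S n"
      by (simp add: proj_def S_def)
    also have "norm (S n) \<le> (\<Sum>k. L * a k)"
    proof -
      have "summable (\<lambda>k. L * a k)"
        using a_sums by (intro summable_mult) (rule sums_summable)
      then show ?thesis
        using S[of n] proj_z[of n] by (metis norm_suminf_le sums_iff)
    qed
    also have "\<dots> = 2 * L * norm x"
      using sums_mult[OF a_sums, of L] by (simp add: sums_iff)
    finally show ?thesis .
  qed
  then have "norm (proj n x) \<le> max 1 (2 * L) * norm x" for n x
    by (meson max.cobounded2 mult_right_mono norm_ge_zero order_trans)
  then show ?thesis
    by (intro exI[of _ "max 1 (2 * L)"]) simp
qed

subsection \<open>Block bases\<close>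

definition basis_const :: real where
  "basis_const = (SOME c. c \<ge> 1 \<and> (\<forall>n x. norm (proj n x) \<le> c * norm x))"

lemma basis_const: "basis_const \<ge> 1" "norm (proj n x) \<le> basis_const * norm x"
  using someI_ex[of "\<lambda>c. c \<ge> 1 \<and> (\<forall>n x. norm (proj n x) \<le> c * norm x)"] ex_basis_constant
  unfolding basis_const_def by blast+

lemma bounded_linear_proj: "bounded_linear (proj n)"
proof (rule bounded_linear_intro)
  show "proj n (x + y) = proj n x + proj n y" "proj n (r *\<^sub>R x) = r *\<^sub>R proj n x" for x y r
    using linear_proj by (simp_all add: linear_add linear_scale)
  show "norm (proj n x) \<le> norm x * basis_const" for x
    using basis_const(2)[of n x] by (simp add: mult.commute)
qed

lemma bounded_linear_coords: "bounded_linear (\<lambda>x. coords e x n)"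
proof (rule bounded_linear_intro)
  show "norm (coords e x n) \<le> norm x * (2 * basis_const)" for x
    using coord_le_proj[OF basis_const(2), of x n] by (simp add: mult_ac)
qed (simp_all add: coords_add coords_scaleR)

lemma coords_sum: "coords e (sum f S) n = (\<Sum>i\<in>S. coords e (f i) n)"
  using linear_sum[OF linear_coords] .

lemma coords_basis: "coords e (e i) j = (if j = i then 1 else 0)"
proof -
  have "(\<lambda>n. (if n = i then 1 else 0) *\<^sub>R e n) sums e i"
    using sums_single[of i e] by (simp add: if_distrib[of "\<lambda>a. a *\<^sub>R _"] cong: if_cong)
  then show ?thesis
    using coords_unique by fastforce
qed

lemma proj_eq: "proj m u = u" if "supp e u \<subseteq> {..<m}"
proof -
  have "proj (n + m) u = proj m u" for n
    unfolding proj_def using that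
    by (intro sum.mono_neutral_right) (auto simp: supp_def subset_iff not_less)
  then have "(\<lambda>n. proj (n + m) u) \<longlonglongrightarrow> proj m u"
    by simp
  then show ?thesis
    using LIMSEQ_unique LIMSEQ_ignore_initial_segment[OF proj_tendsto] by blast
qed

lemma proj_eq_0: "proj m u = 0" if "supp e u \<inter> {..<m} = {}"
  unfolding proj_def using that by (intro sum.neutral) (auto simp: supp_def)

lemma supp_nonempty: "supp e u \<noteq> {}" if "u \<noteq> 0"
  using that proj_eq[of u 0] by (auto simp: proj_def)

lemma finite_supp_rational:
  assumes "u \<in> rational_vectors e F"
  shows "finite (supp e u)"
proof -
  obtain S a where S: "finite S" "u = (\<Sum>n\<in>S. a n *\<^sub>R e n)"
    using assms unfolding rational_vectors_def by blast
  have "coords e u n = (\<Sum>i\<in>S. if n = i then a i else 0)" for n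
    unfolding S(2) coords_sum by (intro sum.cong refl) (simp add: coords_scaleR coords_basis)
  then have "coords e u n = (if n \<in> S then a n else 0)" for n
    using S(1) by (simp add: sum.delta')
  then have "supp e u \<subseteq> S"
    by (auto simp: supp_def)
  then show ?thesis
    using S finite_subset by blast
qed

lemma block_before:
  assumes "block_basis e x" "i < j"
  shows "before e (x i) (x j)"
  using \<open>i < j\<close>
proof (induction j)
  case (Suc j)
  show ?case
  proof (cases "i = j")
    case False
    then have "before e (x i) (x j)" "before e (x j) (x (Suc j))"
      using Suc assms by (auto simp: block_basis_def)
    moreover have "supp e (x j) \<noteq> {}"
      using assms supp_nonempty by (auto simp: block_basis_def)
    ultimately show ?thesis
      by (force simp: before_def)
  qed (use assms in \<open>simp add: block_basis_def\<close>)
qed simp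

text \<open>The minima of successive supports strictly increase. A large index thus guarantees a
  support far out, which is how demands in the games are met.\<close>

lemma block_supp_ge:
  assumes "block_basis e x" "k \<in> supp e (x n)"
  shows "n \<le> k"
  using assms(2)
proof (induction n arbitrary: k)
  case (Suc n)
  obtain l where l: "l \<in> supp e (x n)"
    using assms supp_nonempty by (fastforce simp: block_basis_def)
  then have "l < k"
    using assms Suc.prems by (auto simp: block_basis_def before_def)
  then show ?case
    using Suc.IH[OF l] by simp
qed simp

lemma block_subseq:
  assumes "block_basis e x" "strict_mono \<pi>"
  shows "block_basis e (\<lambda>n. x (\<pi> n))"
  using assms block_before[OF assms(1)] strict_monoD[OF assms(2)]
  by (auto simp: block_basis_def)

definition last_supp :: "(nat \<Rightarrow> 'a) \<Rightarrow> nat \<Rightarrow> nat" where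
  "last_supp x i = Max (supp e (x i))"

text \<open>The coefficient of \<open>x i\<close> is read off at the last coordinate of \<open>x i\<close>, and the sum of the first
  \<open>k\<close> terms is the projection onto the coordinates below \<open>block_end x k\<close>.  Hence both are continuous, and expansions in
  \<open>x\<close> are unique.\<close>

definition block_coeff :: "(nat \<Rightarrow> 'a) \<Rightarrow> nat \<Rightarrow> 'a \<Rightarrow> real" where
  "block_coeff x i u = coords e u (last_supp x i) / coords e (x i) (last_supp x i)"

definition block_end :: "(nat \<Rightarrow> 'a) \<Rightarrow> nat \<Rightarrow> nat" where
  "block_end x k = (case k of 0 \<Rightarrow> 0 | Suc j \<Rightarrow> Suc (last_supp x j))"

context
  fixes x assumes x: "block_basis e x"
begin

lemma last_supp_in_supp: "last_supp x i \<in> supp e (x i)"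
  using x supp_nonempty by (simp add: last_supp_def block_basis_def)

lemma le_last_supp: "k \<in> supp e (x i) \<Longrightarrow> k \<le> last_supp x i"
  using x by (simp add: last_supp_def block_basis_def)

lemma last_supp_ge: "i \<le> last_supp x i"
  using block_supp_ge[OF x last_supp_in_supp] .

lemma proj_block_end: "proj (block_end x k) (x i) = (if i < k then x i else 0)"
proof (cases k)
  case 0
  then show ?thesis
    by (simp add: block_end_def proj_def)
next
  case (Suc j)
  show ?thesis
  proof (cases "i < k")
    case True
    have "l \<le> last_supp x j" if "l \<in> supp e (x i)" for l
    proof (cases "i = j")
      case False
      then have "before e (x i) (x j)"
        using True Suc block_before[OF x] by simp
      then show ?thesis
        using that last_supp_in_supp[of j] by (auto simp: before_def intro: less_imp_le)
    qed (use that le_last_supp in auto)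
    then have "supp e (x i) \<subseteq> {..<block_end x k}"
      by (auto simp: Suc block_end_def less_Suc_eq_le)
    then show ?thesis
      using proj_eq True by simp
  next
    case False
    then have "before e (x j) (x i)"
      using block_before[OF x] Suc by simp
    then have "supp e (x i) \<inter> {..<block_end x k} = {}"
      using last_supp_in_supp[of j] by (fastforce simp: Suc block_end_def before_def)
    then show ?thesis
      using proj_eq_0 False by simp
  qed
qed

lemma block_end_ge: "k \<le> block_end x k"
  using last_supp_ge by (simp add: block_end_def split: nat.split)

lemma bounded_linear_block_coeff: "bounded_linear (block_coeff x i)"
  unfolding block_coeff_def[abs_def]
  by (rule bounded_linear_compose[OF bounded_linear_divide bounded_linear_coords])

lemma block_coeff_block: "block_coeff x i (x j) = (if i = j then 1 else 0)"
proof -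
  have "last_supp x i \<notin> supp e (x j)" if "i \<noteq> j"
    using block_before[OF x, of i j] block_before[OF x, of j i] that last_supp_in_supp[of i]
    by (metis before_def less_irrefl nat_neq_iff)
  then show ?thesis
    using last_supp_in_supp[of i] by (auto simp: block_coeff_def supp_def)
qed

text \<open>Both sides are continuous and linear and agree on every block. Letting \<open>k\<close>
  grow gives the expansion of every \<open>u\<close> in the closed span of \<open>x\<close>.\<close>

lemma proj_block_end_closed_span:
  assumes "u \<in> closed_span (range x)"
  shows "proj (block_end x k) u = (\<Sum>i<k. block_coeff x i u *\<^sub>R x i)"
  using _ _ _ assms
proof (rule bounded_linear_eq_on_closed_span)
  show "bounded_linear (\<lambda>u. \<Sum>i<k. block_coeff x i u *\<^sub>R x i)"
    by (intro bounded_linear_sum bounded_linear_compose[OF bounded_linear_scaleR_left bounded_linear_block_coeff])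
  show "proj (block_end x k) v = (\<Sum>i<k. block_coeff x i v *\<^sub>R x i)" if v: "v \<in> range x" for v
  proof -
    obtain j where "v = x j"
      using v by blast
    then show ?thesis
      by (simp add: proj_block_end block_coeff_block if_distrib[of "\<lambda>a. a *\<^sub>R _"] cong: if_cong)
  qed
qed (rule bounded_linear_proj)

lemma block_coeff_sums:
  assumes "u \<in> closed_span (range x)"
  shows "(\<lambda>i. block_coeff x i u *\<^sub>R x i) sums u"
proof -
  have "filterlim (block_end x) sequentially sequentially"
    by (rule filterlim_at_top_mono[OF filterlim_ident]) (simp add: block_end_ge)
  then have "(\<lambda>k. proj (block_end x k) u) \<longlonglongrightarrow> u"
    using filterlim_compose[OF proj_tendsto] by blast
  then show ?thesis
    by (simp add: sums_def proj_block_end_closed_span[OF assms])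
qed

lemma coords_sums_block:
  assumes "(\<lambda>i. a i *\<^sub>R x i) sums u"
  shows "coords x u = a"
proof -
  have *: "b i = block_coeff x i u" if "(\<lambda>i. b i *\<^sub>R x i) sums u" for b i
  proof -
    have "(\<lambda>j. block_coeff x i (b j *\<^sub>R x j)) sums block_coeff x i u"
      using bounded_linear.sums[OF bounded_linear_block_coeff that] .
    then have "(\<lambda>j. if j = i then b j else 0) sums block_coeff x i u"
      by (simp add: linear_simps[OF bounded_linear_block_coeff] block_coeff_block if_distrib eq_commute cong: if_cong)
    then show ?thesis
      using sums_single[of i b] sums_unique2 by blast
  qed
  show ?thesis
    unfolding coords_def
  proof (rule the_equality)
    show "(\<lambda>i. a i *\<^sub>R x i) sums u" by (fact assms)
    show "b = a" if "(\<lambda>i. b i *\<^sub>R x i) sums u" for b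
      using *[OF assms] *[OF that] by (simp add: fun_eq_iff)
  qed
qed

lemma coords_block:
  assumes "u \<in> closed_span (range x)"
  shows "coords x u i = block_coeff x i u"
  using coords_sums_block[OF block_coeff_sums[OF assms]] by simp

text \<open>A nonzero coefficient of \<open>x i\<close> shows in \<open>u\<close> at the last
  coordinate of \<open>x i\<close>, which is at least \<open>i\<close>.\<close>

lemma supp_block_subset:
  assumes "u \<in> closed_span (range x)" "supp e u \<subseteq> {..<m}"
  shows "supp x u \<subseteq> {..<m}"
proof
  fix i assume "i \<in> supp x u"
  then have "last_supp x i \<in> supp e u"
    by (auto simp: supp_def coords_block[OF assms(1)] block_coeff_def)
  then show "i \<in> {..<m}"
    using assms(2) last_supp_ge[of i] by auto
qed

lemma eq_block_sum:
  assumes "u \<in> closed_span (range x)" "supp x u \<subseteq> {..<m}"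
  shows "u = (\<Sum>i<m. coords x u i *\<^sub>R x i)"
proof -
  have "(\<lambda>i. coords x u i *\<^sub>R x i) sums (\<Sum>i<m. coords x u i *\<^sub>R x i)"
    using assms(2) by (intro sums_finite) (auto simp: supp_def subset_iff)
  moreover have "(\<lambda>i. coords x u i *\<^sub>R x i) sums u"
    using block_coeff_sums[OF assms(1)] by (simp add: coords_block[OF assms(1)])
  ultimately show ?thesis
    using sums_unique2 by blast
qed

lemma supp_closed_span_image:
  assumes "u \<in> closed_span (x ` S)"
  shows "supp x u \<subseteq> S"
proof
  fix i assume i: "i \<in> supp x u"
  have u: "u \<in> closed_span (range x)"
    using assms closed_span_mono[of "x ` S" "range x"] by blast
  have "block_coeff x i u = 0" if "i \<notin> S"
  proof (rule bounded_linear_eq_on_closed_span[of "block_coeff x i" "\<lambda>_. 0" "x ` S"])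
    show "block_coeff x i v = 0" if "v \<in> x ` S" for v
      using that \<open>i \<notin> S\<close> by (auto simp: block_coeff_block)
  qed (simp_all add: bounded_linear_block_coeff assms)
  then show "i \<in> S"
    using i by (auto simp: supp_def coords_block[OF u])
qed

text \<open>\<open>proj (block_end x l)\<close> cuts the longer sum down to the shorter, so a block
  basis inherits the basis constant of \<open>e\<close>.\<close>

lemma norm_block_initial:
  assumes "l \<le> k"
  shows "norm (\<Sum>i<l. a i *\<^sub>R x i) \<le> basis_const * norm (\<Sum>i<k. a i *\<^sub>R x i)"
proof -
  have "proj (block_end x l) (\<Sum>i<k. a i *\<^sub>R x i) = (\<Sum>i<k. if i < l then a i *\<^sub>R x i else 0)"
    by (auto simp: linear_sum[OF linear_proj] linear_scale[OF linear_proj] proj_block_end intro: sum.cong)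
  also have "\<dots> = (\<Sum>i<l. a i *\<^sub>R x i)"
    by (rule sum.mono_neutral_cong_right) (use assms in auto)
  finally show ?thesis
    using basis_const(2) by metis
qed

lemma norm_block_coeff:
  assumes "norm (x l) = 1" "l < k"
  shows "\<bar>a l\<bar> \<le> 2 * basis_const * norm (\<Sum>i<k. a i *\<^sub>R x i)"
proof -
  have "\<bar>a l\<bar> = norm ((\<Sum>i<Suc l. a i *\<^sub>R x i) - (\<Sum>i<l. a i *\<^sub>R x i))"
    by (simp add: assms)
  also have "\<dots> \<le> norm (\<Sum>i<Suc l. a i *\<^sub>R x i) + norm (\<Sum>i<l. a i *\<^sub>R x i)"
    by (rule norm_triangle_ineq4)
  also have "\<dots> \<le> 2 * basis_const * norm (\<Sum>i<k. a i *\<^sub>R x i)"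
    using norm_block_initial[of l k a] norm_block_initial[of "Suc l" k a] assms by linarith
  finally show ?thesis .
qed

end

section \<open>Substitution along \<open>star\<close> and perturbation estimates\<close>

lemma star_eq:
  assumes "supp x (v n) \<subseteq> {..<N}"
  shows "star x v u n = (\<Sum>j<N. coords x (v n) j *\<^sub>R u j)"
  unfolding star_def using assms by (intro sum.mono_neutral_left) (auto simp: supp_def)

text \<open>The coefficients on the right do not depend on \<open>u\<close>. Norm comparisons
  between two choices of \<open>u\<close> therefore pass to the sequences obtained by
  substitution.\<close>

lemma sum_star:
  assumes "\<And>n. n < k \<Longrightarrow> supp x (v n) \<subseteq> {..<N}"
  shows "(\<Sum>n<k. a n *\<^sub>R star x v u n) = (\<Sum>j<N. (\<Sum>n<k. a n * coords x (v n) j) *\<^sub>R u j)"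
proof -
  have "(\<Sum>n<k. a n *\<^sub>R star x v u n) = (\<Sum>n<k. \<Sum>j<N. (a n * coords x (v n) j) *\<^sub>R u j)"
    by (intro sum.cong refl) (simp add: star_eq[OF assms] scaleR_sum_right)
  also have "\<dots> = (\<Sum>j<N. (\<Sum>n<k. a n * coords x (v n) j) *\<^sub>R u j)"
    by (subst sum.swap) (simp add: scaleR_left.sum)
  finally show ?thesis .
qed

lemma star_self:
  assumes "block_basis e x" "v n \<in> closed_span (range x)" "finite (supp e (v n))"
  shows "star x v x n = v n"
proof -
  obtain m where m: "supp e (v n) \<subseteq> {..<m}"
    using assms(3) finite_nat_iff_bounded by blast
  then have "supp x (v n) \<subseteq> {..<m}"
    using assms supp_block_subset by blast
  then show ?thesis
    using star_eq eq_block_sum assms by metis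
qed

text \<open>At most \<open>l\<close> terms change, each by a vector of norm at most 2, and its
  coefficient is at most \<open>2 * basis_const\<close> times the norm of the sum over
  \<open>z\<close>.\<close>

lemma norm_change_initial:
  assumes z: "block_basis e z" "\<And>n. norm (z n) = 1" and z': "\<And>n. norm (z' n) = 1" "\<And>n. n \<ge> l \<Longrightarrow> z' n = z n"
  shows "norm (\<Sum>n<N. b n *\<^sub>R z' n) \<le> (1 + 4 * basis_const * l) * norm (\<Sum>n<N. b n *\<^sub>R z n)"
proof -
  let ?s = "norm (\<Sum>n<N. b n *\<^sub>R z n)"
  have "(\<Sum>n<N. b n *\<^sub>R z' n) - (\<Sum>n<N. b n *\<^sub>R z n) = (\<Sum>n<N. b n *\<^sub>R (z' n - z n))"
    by (simp add: sum_subtractf scaleR_diff_right)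
  also have "\<dots> = (\<Sum>n<min N l. b n *\<^sub>R (z' n - z n))"
    by (intro sum.mono_neutral_right) (auto simp: z'(2))
  finally have "norm ((\<Sum>n<N. b n *\<^sub>R z' n) - (\<Sum>n<N. b n *\<^sub>R z n)) \<le> (\<Sum>n<min N l. norm (b n *\<^sub>R (z' n - z n)))"
    by (simp only: norm_sum)
  also have "\<dots> \<le> (\<Sum>n<min N l. 4 * basis_const * ?s)"
  proof (rule sum_mono)
    fix n assume "n \<in> {..<min N l}"
    then have "\<bar>b n\<bar> \<le> 2 * basis_const * ?s"
      using norm_block_coeff[OF z(1), of n N b] z(2) by simp
    moreover have "norm (z' n - z n) \<le> 2"
      using norm_triangle_ineq4[of "z' n" "z n"] z z' by simp
    ultimately have "\<bar>b n\<bar> * norm (z' n - z n) \<le> (2 * basis_const * ?s) * 2"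
      by (intro mult_mono) auto
    then show "norm (b n *\<^sub>R (z' n - z n)) \<le> 4 * basis_const * ?s"
      by simp
  qed
  also have "\<dots> = real (min N l) * (4 * basis_const * ?s)"
    by simp
  also have "\<dots> \<le> real l * (4 * basis_const * ?s)"
    using basis_const(1) by (intro mult_right_mono) auto
  finally have "norm ((\<Sum>n<N. b n *\<^sub>R z' n) - (\<Sum>n<N. b n *\<^sub>R z n)) \<le> 4 * basis_const * l * ?s"
    by (simp add: mult_ac)
  then show ?thesis
    using norm_triangle_sub[of "\<Sum>n<N. b n *\<^sub>R z' n" "\<Sum>n<N. b n *\<^sub>R z n"] by (simp add: algebra_simps)
qed

text \<open>Small perturbations: the factor \<open>4 * basis_const * K\<close> absorbs the
  coefficient bound \<open>2 * basis_const\<close>, so the total error is at most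
  \<open>1 / (2 * K)\<close> times the norm of the sum over \<open>y\<close>, and the constant only
  doubles.\<close>

lemma equiv_upto_perturb:
  assumes y: "block_basis e y" "\<And>n. norm (y n) = 1" and uy: "equiv_upto K k u y" and K: "K \<ge> 1"
    and uv: "\<And>n. norm (u n - v n) \<le> (1/2)^Suc n / (4 * basis_const * K)"
  shows "equiv_upto (2 * K) k v y"
  unfolding equiv_upto_def
proof
  fix a :: "nat \<Rightarrow> real"
  let ?u = "\<Sum>n<k. a n *\<^sub>R u n" and ?v = "\<Sum>n<k. a n *\<^sub>R v n" and ?s = "norm (\<Sum>n<k. a n *\<^sub>R y n)"
  have pos: "basis_const > 0"
    using basis_const(1) by linarith
  have "norm (?u - ?v) = norm (\<Sum>n<k. a n *\<^sub>R (u n - v n))"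
    by (simp add: sum_subtractf scaleR_diff_right)
  also have "\<dots> \<le> (\<Sum>n<k. \<bar>a n\<bar> * norm (u n - v n))"
    using norm_sum[of "\<lambda>n. a n *\<^sub>R (u n - v n)" "{..<k}"] by simp
  also have "\<dots> \<le> (\<Sum>n<k. (2 * basis_const * ?s) * ((1/2)^Suc n / (4 * basis_const * K)))"
    using uv norm_block_coeff[OF y(1), of _ k a] y(2) pos by (intro sum_mono mult_mono) auto
  also have "\<dots> = (\<Sum>n<k. ?s / (2 * K) * (1/2)^Suc n)"
    using pos K by (intro sum.cong) (auto simp: field_simps)
  also have "\<dots> = ?s / (2 * K) * (\<Sum>n<k. (1/2)^Suc n)"
    by (simp only: sum_distrib_left)
  also have "(\<Sum>n<k. (1/2::real)^Suc n) = 1 - (1/2)^k"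
    by (induction k) simp_all
  also have "?s / (2 * K) * (1 - (1/2)^k) \<le> ?s / (2 * K) * 1"
    using K by (intro mult_left_mono) auto
  finally have diff: "norm (?u - ?v) \<le> ?s / (2 * K)"
    by simp
  have "norm ?u \<le> K * ?s" and lower: "?s \<le> K * norm ?u"
    using uy by (auto simp: equiv_upto_def)
  moreover have "norm ?v \<le> norm ?u + norm (?u - ?v)"
    using norm_triangle_sub[of ?v ?u] by (simp add: norm_minus_commute)
  moreover have "?s / (2 * K) \<le> K * ?s"
    using mult_right_mono[of "1 / (2 * K)" K ?s] K by (simp add: field_simps) (smt (verit) mult_le_cancel_left1)
  moreover have "norm ?u \<le> norm ?v + ?s / (2 * K)"
    using norm_triangle_sub[of ?u ?v] diff by simp
  then have "K * norm ?u \<le> K * norm ?v + ?s / 2"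
    using K mult_left_mono[of "norm ?u" "norm ?v + ?s / (2 * K)" K] by (simp add: field_simps)
  ultimately show "norm ?v \<le> 2 * K * ?s \<and> ?s \<le> 2 * K * norm ?v"
    using diff by linarith
qed

end

subsection \<open>The asymptotic game\<close>

locale admissible_blocks = normalized_schauder_basis e for e :: "nat \<Rightarrow> 'a::banach" +
  fixes F :: "real set" and D :: "'a set" and A :: "(nat \<Rightarrow> 'a) set"
  assumes scalars: "scalar_field e F" and system: "admissible_system e F D A"
begin

section \<open>Consequences of the axioms of an admissible system\<close>

lemma D_rational: "D \<subseteq> rational_vectors e F"
  using system by (simp add: admissible_system_def set_of_blocks_def)

lemma e_in_D: "e n \<in> D"
  using system by (simp add: admissible_system_def set_of_blocks_def)

lemma finite_supp_D: "u \<in> D \<Longrightarrow> finite (supp e u)"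
  using D_rational finite_supp_rational by blast

lemma A_in_D: "u \<in> A \<Longrightarrow> u n \<in> D"
  using system closedin_subset[of "product_topology (\<lambda>_. discrete_topology D) UNIV" A]
  by (auto simp: admissible_system_def admissible_set_def)

lemma block_seq_in_A: "block_seq e D x \<Longrightarrow> x \<in> A"
  using system by (simp add: admissible_system_def admissible_set_def)

lemma star_in_A_iff:
  assumes "y \<in> A" "block_subspace e D x" "\<And>n. u n \<in> D" "\<And>n. u n \<in> closed_span (range x)"
  shows "star x u y \<in> A \<longleftrightarrow> u \<in> A"
  using system assms by (simp add: admissible_system_def admissible_set_def blocks_in_def)

text \<open>Serves to complete a finite position inside a given block subspace, since the axiom on
  \<open>star\<close> concerns infinite sequences.\<close>

lemma A_extend:
  assumes "block_seq e D y" "u \<in> A"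
  obtains v where "v \<in> A" "\<And>i. i \<le> k \<Longrightarrow> v i = u i" "\<And>i. i > k \<Longrightarrow> v i \<in> closed_span (range y)"
proof -
  obtain v where v: "\<And>n. v n \<in> closed_span (range y)" "(\<lambda>i. if i \<le> k then u i else v (i - Suc k)) \<in> A"
    using system assms unfolding admissible_system_def admissible_set_def by meson
  show ?thesis
    by (rule that[OF v(2)]) (use v(1) in auto)
qed

text \<open>A basic neighbourhood in a product of discrete spaces constrains finitely many
  coordinates, and some element of \<open>A\<close> agrees with \<open>u\<close> on all of
  these.\<close>

lemma A_closed:
  assumes "\<And>k. initial_segment A (map u [0..<k])"
  shows "u \<in> A"
proof (rule ccontr)
  assume "u \<notin> A"
  let ?T = "product_topology (\<lambda>_. discrete_topology D) UNIV :: (nat \<Rightarrow> 'a) topology"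
  have "closedin ?T A"
    using system by (simp add: admissible_system_def admissible_set_def)
  then have "openin ?T (topspace ?T - A)"
    by (simp add: closedin_def)
  moreover have "u n \<in> D" for n
  proof -
    obtain v where "v \<in> A" "u n = v n"
      using assms[of "Suc n"] unfolding initial_segment_def
      by (metis diff_zero length_map length_upt lessI nth_map_upt plus_nat.add_0)
    then show ?thesis
      using A_in_D by simp
  qed
  then have "u \<in> topspace ?T - A"
    using \<open>u \<notin> A\<close> by auto
  ultimately have "\<exists>U. finite {i \<in> UNIV. U i \<noteq> topspace (discrete_topology D)} \<and>
      (\<forall>i\<in>UNIV. openin (discrete_topology D) (U i)) \<and> u \<in> Pi\<^sub>E UNIV U \<and> Pi\<^sub>E UNIV U \<subseteq> topspace ?T - A"
    unfolding openin_product_topology_alt by blast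
  then obtain U where U: "finite {i. U i \<noteq> D}" "u \<in> Pi\<^sub>E UNIV U" "Pi\<^sub>E UNIV U \<subseteq> topspace ?T - A"
    by auto
  then obtain k where k: "{i. U i \<noteq> D} \<subseteq> {..<k}"
    using finite_nat_iff_bounded by blast
  obtain v where v: "v \<in> A" "\<And>i. i < k \<Longrightarrow> u i = v i"
    using assms[of k] by (auto simp: initial_segment_def)
  have "v i \<in> U i" for i
  proof (cases "i < k")
    case True
    then show ?thesis
      using U(2) v(2) by (metis PiE_mem UNIV_I)
  next
    case False
    then have "U i = D"
      using k by auto
    then show ?thesis
      using A_in_D v(1) by simp
  qed
  then have "v \<in> Pi\<^sub>E UNIV U"
    by auto
  then show False
    using U(3) v(1) by blast
qed

lemma block_subspaceD:
  assumes "block_subspace e D x"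
  shows "block_basis e x" "x n \<in> D" "norm (x n) = 1" "block_seq e D x" "x \<in> A"
  using assms block_seq_in_A by (simp_all add: block_subspace_def block_seq_def normalized_def)

lemma block_subspace_subseq:
  assumes "block_subspace e D x" "strict_mono \<pi>"
  shows "block_subspace e D (\<lambda>n. x (\<pi> n))"
  using assms block_subseq by (simp add: block_subspace_def block_seq_def normalized_def)

lemma closed_span_supp_bounded:
  assumes "block_basis e x" "u \<in> D" "u \<in> closed_span (range x)"
  obtains m where "supp x u \<subseteq> {..<m}"
  using assms finite_supp_D supp_block_subset finite_nat_iff_bounded by metis

text \<open>Blocks have finite support, so a block of the closed span already lies in the algebraic
  span, as the rules of the games demand.\<close>

lemma in_span_supp:
  assumes "block_basis e x" "u \<in> D" "u \<in> closed_span (range x)" "supp x u \<subseteq> S"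
  shows "u \<in> span (x ` S)"
proof -
  obtain m where m: "supp x u \<subseteq> {..<m}"
    using closed_span_supp_bounded assms by blast
  have "(\<Sum>i<m. coords x u i *\<^sub>R x i) \<in> span (x ` S)"
  proof (rule span_sum)
    show "coords x u i *\<^sub>R x i \<in> span (x ` S)" for i
      using assms(4) by (cases "coords x u i = 0") (auto simp: supp_def span_zero intro: span_scale span_base)
  qed
  then show ?thesis
    using eq_block_sum[OF assms(1,3) m] by simp
qed

text \<open>The blocks that II has put at her disposal. Her vectors may combine old and new ones,
  because admissible sequences need not be block sequences.\<close>

definition pool :: "('a set \<times> 'a) list \<Rightarrow> 'a set" where
  "pool p = \<Union>(fst ` set p)"

text \<open>The asymptotic game for the sequence \<open>y\<close> in the space with basis \<open>z\<close>: player I plays \<open>n\<close>, and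
  player II answers with \<open>q\<close>.  A position \<open>p\<close> lists II's moves only.  II wins if she can move forever.\<close>

definition legal ::
    "real \<Rightarrow> (nat \<Rightarrow> 'a) \<Rightarrow> (nat \<Rightarrow> 'a) \<Rightarrow> nat \<Rightarrow> ('a set \<times> 'a) list \<Rightarrow> 'a set \<times> 'a \<Rightarrow> bool" where
  "legal C y z n p q \<longleftrightarrow>
     finite (fst q) \<and> fst q \<subseteq> D \<inter> closed_span (range z) \<and> (\<forall>v\<in>fst q. supp e v \<subseteq> {n..}) \<and>
     snd q \<in> span (pool p \<union> fst q) \<and>
     initial_segment A (map snd (p @ [q])) \<and>
     equiv_upto C (Suc (length p)) ((!) (map snd (p @ [q]))) y"

definition I_wins :: "real \<Rightarrow> (nat \<Rightarrow> 'a) \<Rightarrow> (nat \<Rightarrow> 'a) \<Rightarrow> ('a set \<times> 'a) list \<Rightarrow> bool" where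
  "I_wins C y z p \<longleftrightarrow>
     (\<exists>\<sigma>. \<forall>r. \<exists>k. \<not> legal C y z (\<sigma> (p @ map r [0..<k])) (p @ map r [0..<k]) (r k))"

text \<open>The step of Gale-Stewart determinacy: if every legal answer to \<open>n\<close> led to a
  win for I, then playing \<open>n\<close> and continuing with the strategy chosen for that answer
  would win at \<open>p\<close>.\<close>

lemma not_I_wins_move:
  assumes "\<not> I_wins C y z p"
  shows "\<exists>q. legal C y z n p q \<and> \<not> I_wins C y z (p @ [q])"
proof (rule ccontr)
  assume "\<not> ?thesis"
  then have "\<forall>q. \<exists>\<tau>. legal C y z n p q \<longrightarrow>
      (\<forall>r. \<exists>k. \<not> legal C y z (\<tau> ((p @ [q]) @ map r [0..<k])) ((p @ [q]) @ map r [0..<k]) (r k))"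
    unfolding I_wins_def by metis
  then obtain \<tau> where \<tau>: "\<And>q r. legal C y z n p q \<Longrightarrow>
      \<exists>k. \<not> legal C y z (\<tau> q ((p @ [q]) @ map r [0..<k])) ((p @ [q]) @ map r [0..<k]) (r k)"
    by metis
  \<comment> \<open>The first answer of II is recovered from a later position \<open>t\<close> as
    its entry number \<open>length p\<close>.\<close>
  define \<sigma> where "\<sigma> t = (if t = p then n else \<tau> (t ! length p) t)" for t
  have "\<exists>k. \<not> legal C y z (\<sigma> (p @ map r [0..<k])) (p @ map r [0..<k]) (r k)" for r
  proof (cases "legal C y z n p (r 0)")
    case False
    then show ?thesis
      by (intro exI[of _ 0]) (simp add: \<sigma>_def)
  next
    case True
    have eq: "(p @ [r 0]) @ map (\<lambda>i. r (Suc i)) [0..<k] = p @ map r [0..<Suc k]" for k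
      by (simp add: upt_rec[of 0 "Suc k"] map_Suc_upt[symmetric] del: upt_Suc)
    obtain k where "\<not> legal C y z (\<tau> (r 0) (p @ map r [0..<Suc k])) (p @ map r [0..<Suc k]) (r (Suc k))"
      using \<tau>[OF True, of "\<lambda>i. r (Suc i)"] unfolding eq by blast
    moreover have "\<sigma> (p @ map r [0..<Suc k]) = \<tau> (r 0) (p @ map r [0..<Suc k])"
      by (simp add: \<sigma>_def nth_append del: upt_Suc)
    ultimately show ?thesis
      by metis
  qed
  then show False
    using assms unfolding I_wins_def by blast
qed

subsection \<open>Tightness\<close>

text \<open>The vectors of an embedding that avoids \<open>{l..b}\<close> can be moved into the coordinates from \<open>b - l\<close>
  on, at the cost of a constant that depends on \<open>l\<close> only.\<close>

lemma relocate:
  assumes x: "block_subspace e D x" and "l \<le> b" and T: "T \<inter> {l..b} = {}"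
    and u: "u \<in> A" "\<And>n. u n \<in> closed_span (x ` T)"
  shows "\<exists>v\<in>A. (\<forall>n. v n \<in> closed_span (x ` ({b - l..<b} \<union> T \<inter> {b<..}))) \<and>
           (\<forall>k. equiv_upto (1 + 4 * basis_const * l) k v u)"
proof -
  \<comment> \<open>\<open>\<pi>\<close> enumerates the complement of \<open>{l..b}\<close> and
    \<open>\<pi>'\<close> the set \<open>{b - l..<b} \<union> {b<..}\<close>; they agree from index
    \<open>l\<close> on.\<close>
  define d where "d = Suc b - l"
  define \<pi> where "\<pi> n = (if n < l then n else n + d)" for n
  define \<pi>' where "\<pi>' n = (if n < l then b - l + n else n + d)" for n
  define z where "z = (\<lambda>n. x (\<pi> n))"
  define z' where "z' = (\<lambda>n. x (\<pi>' n))"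
  have mono: "strict_mono \<pi>" "strict_mono \<pi>'"
    using \<open>l \<le> b\<close> by (auto simp: strict_mono_def \<pi>_def \<pi>'_def d_def)
  have z: "block_subspace e D z" and z': "block_subspace e D z'"
    unfolding z_def z'_def by (rule block_subspace_subseq[OF x mono(1)], rule block_subspace_subseq[OF x mono(2)])
  have "i \<in> range \<pi>" if "i \<in> T" for i
  proof (cases "i < l")
    case True
    then show ?thesis
      by (auto simp: \<pi>_def image_iff intro!: exI[of _ i])
  next
    case False
    then have "i > b"
      using that T by force
    then show ?thesis
      using \<open>l \<le> b\<close> by (auto simp: \<pi>_def image_iff d_def intro!: exI[of _ "i - d"])
  qed
  then have "T = \<pi> ` (\<pi> -` T)"
    by (simp add: image_vimage_eq Int_absorb2 subsetI)
  then have "x ` T = z ` (\<pi> -` T)"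
    unfolding z_def image_image[symmetric, of x \<pi>] by (rule arg_cong)
  then have uz: "u n \<in> closed_span (z ` (\<pi> -` T))" for n
    using u(2) by simp
  have uD: "u n \<in> D" for n
    using A_in_D u(1) .
  have u_span: "u n \<in> closed_span (range z)" for n
    using uz closed_span_mono[of "z ` (\<pi> -` T)" "range z"] by blast
  have supp_u: "supp z (u n) \<subseteq> \<pi> -` T" for n
    using supp_closed_span_image[OF block_subspaceD(1)[OF z] uz] .
  \<comment> \<open>Transplanting expansions from \<open>z\<close> to \<open>z'\<close> stays inside
    \<open>A\<close>, and only the first \<open>l\<close> basis terms change.\<close>
  define v where "v = star z u z'"
  have "v \<in> A"
    unfolding v_def using star_in_A_iff[OF block_subspaceD(5)[OF z'] z uD u_span] u(1) by simp
  moreover have "v n \<in> closed_span (x ` ({b - l..<b} \<union> T \<inter> {b<..}))" for n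
    unfolding v_def star_def
  proof (intro subspace_sum subspace_scale subspace_closed_span)
    fix i assume "i \<in> supp z (u n)"
    then have "\<pi> i \<in> T"
      using supp_u by blast
    then have "\<pi>' i \<in> {b - l..<b} \<union> T \<inter> {b<..}"
      using \<open>l \<le> b\<close> by (auto simp: \<pi>'_def \<pi>_def d_def split: if_splits)
    then show "z' i \<in> closed_span (x ` ({b - l..<b} \<union> T \<inter> {b<..}))"
      using closed_span_superset by (fastforce simp: z'_def)
  qed
  moreover have "equiv_upto (1 + 4 * basis_const * l) k v u" for k
    unfolding equiv_upto_def
  proof
    fix a :: "nat \<Rightarrow> real"
    have "\<exists>m. supp z (u n) \<subseteq> {..<m}" for n
      using closed_span_supp_bounded[OF block_subspaceD(1)[OF z] uD u_span] by metis
    then obtain m where m: "\<And>n. supp z (u n) \<subseteq> {..<m n}"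
      by metis
    define N where "N = (\<Sum>n<k. m n)"
    have N: "supp z (u n) \<subseteq> {..<N}" if "n < k" for n
      using m[of n] member_le_sum[of n "{..<k}" m] that by (fastforce simp: N_def)
    define c where "c j = (\<Sum>n<k. a n * coords z (u n) j)" for j
    have "star z u z n = u n" for n
      by (rule star_self[OF block_subspaceD(1)[OF z] u_span finite_supp_D[OF uD]])
    then have "(\<Sum>n<k. a n *\<^sub>R u n) = (\<Sum>j<N. c j *\<^sub>R z j)"
      using sum_star[where x = z and v = u and u = z and N = N and k = k and a = a] N by (simp add: c_def)
    moreover have "(\<Sum>n<k. a n *\<^sub>R v n) = (\<Sum>j<N. c j *\<^sub>R z' j)"
      unfolding v_def c_def by (rule sum_star[OF N])
    moreover have "z n = z' n" if "n \<ge> l" for n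
      using that by (simp add: z_def z'_def \<pi>_def \<pi>'_def)
    ultimately show "norm (\<Sum>n<k. a n *\<^sub>R v n) \<le> (1 + 4 * basis_const * l) * norm (\<Sum>n<k. a n *\<^sub>R u n) \<and>
        norm (\<Sum>n<k. a n *\<^sub>R u n) \<le> (1 + 4 * basis_const * l) * norm (\<Sum>n<k. a n *\<^sub>R v n)"
      using norm_change_initial[of z z' l] norm_change_initial[of z' z l] block_subspaceD(1,3)[OF z] block_subspaceD(1,3)[OF z']
      by simp
  qed
  ultimately show ?thesis
    by blast
qed

text \<open>The finiteness for each single support is collected over the finitely many subsets of
  \<open>{..<m}\<close>; a set that is not the support of a block contributes nothing.\<close>

lemma nets:
  assumes "block_subspace e D x" "\<And>n. 0 < \<delta> n \<and> \<delta> n < 1" "K \<ge> (1::real)"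
  shows "\<exists>B. (\<forall>n m. finite {u \<in> B n. supp x u \<subseteq> {..<m}}) \<and>
      (\<forall>w\<in>A. (\<forall>n. w n \<in> closed_span (range x)) \<longrightarrow> (\<forall>n. 1 / K \<le> norm (w n) \<and> norm (w n) \<le> K) \<longrightarrow>
        (\<exists>u\<in>A. \<forall>n. u n \<in> closed_span (range x) \<and> u n \<in> B n \<and> supp x (u n) \<subseteq> supp x (w n) \<and> norm (w n - u n) < \<delta> n))"
proof -
  have "\<exists>B :: nat \<Rightarrow> 'a set.
           (\<forall>n. B n \<noteq> {} \<and> B n \<subseteq> blocks_in D x) \<and>
           (\<forall>n d. finite d \<longrightarrow> (\<exists>w\<in>blocks_in D x. supp x w = d) \<longrightarrow>
              finite {u \<in> B n. supp x u = d}) \<and>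
           (\<forall>w \<in> seqs_in A (closed_span (range x)).
              (\<forall>i. 1 / K \<le> norm (w i) \<and> norm (w i) \<le> K) \<longrightarrow>
              (\<exists>u \<in> seqs_in A (closed_span (range x)).
                 \<forall>n. u n \<in> B n \<and> supp x (u n) \<subseteq> supp x (w n) \<and> norm (w n - u n) < \<delta> n))"
    using system assms unfolding admissible_system_def by blast
  then obtain B where B: "\<forall>n. B n \<noteq> {} \<and> B n \<subseteq> blocks_in D x"
      "\<forall>n d. finite d \<longrightarrow> (\<exists>w\<in>blocks_in D x. supp x w = d) \<longrightarrow> finite {u \<in> B n. supp x u = d}"
      "\<forall>w \<in> seqs_in A (closed_span (range x)). (\<forall>i. 1 / K \<le> norm (w i) \<and> norm (w i) \<le> K) \<longrightarrow>
              (\<exists>u \<in> seqs_in A (closed_span (range x)).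
                 \<forall>n. u n \<in> B n \<and> supp x (u n) \<subseteq> supp x (w n) \<and> norm (w n - u n) < \<delta> n)"
    by (elim exE conjE)
  show ?thesis
  proof (intro exI[of _ B] conjI allI ballI impI)
    show "finite {u \<in> B n. supp x u \<subseteq> {..<m}}" for n m
    proof -
      have "finite {u \<in> B n. supp x u = d}" if "d \<subseteq> {..<m}" for d
      proof (cases "\<exists>w\<in>blocks_in D x. supp x w = d")
        case True
        then show ?thesis
          using B(2) finite_subset[OF that] by blast
      next
        case False
        then have "{u \<in> B n. supp x u = d} = {}"
          using B(1) by blast
        then show ?thesis
          by (metis finite.emptyI)
      qed
      then have "finite (\<Union>d\<in>Pow {..<m}. {u \<in> B n. supp x u = d})"
        by (intro finite_UN_I) auto
      then show ?thesis
        by (rule finite_subset[rotated]) auto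
    qed
    show "\<exists>u\<in>A. \<forall>n. u n \<in> closed_span (range x) \<and> u n \<in> B n \<and> supp x (u n) \<subseteq> supp x (w n) \<and> norm (w n - u n) < \<delta> n"
      if "w \<in> A" "\<forall>n. w n \<in> closed_span (range x)" "\<forall>n. 1 / K \<le> norm (w n) \<and> norm (w n) \<le> K" for w
    proof -
      have "w \<in> seqs_in A (closed_span (range x))"
        using that by (simp add: seqs_in_def)
      from B(3)[rule_format, OF this] that(3) show ?thesis
        unfolding seqs_in_def by blast
    qed
  qed
qed

text \<open>An embedding that avoids infinitely many intervals is relocated past I's first number,
  approximated from a net, and read as a play of II against I's strategy. Each later avoided
  interval carries II past I's next number.\<close>

theorem tight_if_I_wins:
  assumes x: "block_subspace e D x" and y: "block_subspace e D y"
    and I_wins: "\<And>t::nat. I_wins t y x []"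
  shows "A_tight_in A y x"
proof -
  note xb = block_subspaceD[OF x] and yb = block_subspaceD[OF y]
  txt \<open>An embedding with constant \<open>K\<close> that avoids the \<open>j\<close>-th interval, where \<open>j \<ge> K\<close> and the interval begins
    at \<open>l\<close>, becomes after relocation an embedding with constant \<open>C j l\<close>.  So the strategies for all
    constants up to \<open>C j l\<close> determine the end \<open>\<beta> j l\<close> of this interval.\<close>
  obtain c :: nat where c: "4 * basis_const \<le> c"
    using real_arch_simple by blast
  \<comment> \<open>A bound for the loss \<open>1 + 4 * basis_const * l\<close> of relocation times
    an embedding constant \<open>K \<le> j\<close>. It is a natural number so that
    \<open>\<beta>\<close> can sum over all constants up to it.\<close>
  define C where "C j l = Suc j * (1 + c * l)" for j l :: nat
  have C_pos: "real (C j l) \<ge> 1" for j l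
    by (simp add: C_def del: of_nat_add of_nat_mult of_nat_Suc)
  have C_mono: "C i l \<le> C j m" if "i \<le> j" "l \<le> m" for i j l m
    unfolding C_def using that by (intro mult_le_mono) auto
  \<comment> \<open>The constant is \<open>2 * t\<close> because passing to a net doubles the
    constant \<open>t\<close>.\<close>
  obtain \<sigma> where \<sigma>: "\<And>t r. \<exists>k. \<not> legal (real (2 * t)) y x (\<sigma> t (map r [0..<k])) (map r [0..<k]) (r k)"
    using I_wins[of "2 * _"] unfolding I_wins_def append_Nil by metis
  \<comment> \<open>\<open>Suc t\<close> keeps the constant of every net at least 1; a constant
    \<open>t \<ge> 1\<close> uses the net with index \<open>t - 1\<close>.\<close>
  define \<delta> where "\<delta> t n = (1/2)^Suc n / (4 * basis_const * real (Suc t))" for t n :: nat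
  have \<delta>: "0 < \<delta> t n \<and> \<delta> t n < 1" for t n
  proof -
    have "1 \<le> basis_const * real (Suc t)"
      using basis_const(1) mult_mono[of 1 basis_const 1 "real (Suc t)"] by simp
    moreover have "(1/2::real)^Suc n \<le> 1"
      by (rule power_le_one) auto
    ultimately have "(1/2)^Suc n < 4 * basis_const * real (Suc t)"
      by linarith
    then show ?thesis
      unfolding \<delta>_def using basis_const(1) by (simp add: divide_less_eq)
  qed
  define Q where "Q t B \<longleftrightarrow> (\<forall>n m. finite {u \<in> B n. supp x u \<subseteq> {..<m}}) \<and>
      (\<forall>w\<in>A. (\<forall>n. w n \<in> closed_span (range x)) \<longrightarrow> (\<forall>n. 1 / real (Suc t) \<le> norm (w n) \<and> norm (w n) \<le> real (Suc t)) \<longrightarrow>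
        (\<exists>u\<in>A. \<forall>n. u n \<in> closed_span (range x) \<and> u n \<in> B n \<and> supp x (u n) \<subseteq> supp x (w n) \<and> norm (w n - u n) < \<delta> t n))"
    for t :: nat and B :: "nat \<Rightarrow> 'a set"
  have "\<exists>B. Q t B" for t
    unfolding Q_def by (rule nets[OF x \<delta>]) simp
  then obtain B where "\<And>t. Q t (B t)"
    by metis
  then have B: "\<And>t n m. finite {u \<in> B t n. supp x u \<subseteq> {..<m}}"
    and net: "\<And>t w. w \<in> A \<Longrightarrow> \<forall>n. w n \<in> closed_span (range x) \<Longrightarrow>
        \<forall>n. 1 / real (Suc t) \<le> norm (w n) \<and> norm (w n) \<le> real (Suc t) \<Longrightarrow>
        \<exists>u\<in>A. \<forall>n. u n \<in> closed_span (range x) \<and> u n \<in> B t n \<and> supp x (u n) \<subseteq> supp x (w n) \<and> norm (w n - u n) < \<delta> t n"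
    unfolding Q_def by blast+
  \<comment> \<open>Positions with at most \<open>j\<close> moves that use only \<open>x i\<close>
    with \<open>i < l\<close> and net vectors supported below \<open>l\<close>. They are finitely
    many, so one interval can outlast I's answers to all of them.\<close>
  define P where "P t j l = {p. set p \<subseteq> Pow (x ` {..<l}) \<times> (\<Union>n<j. {u \<in> B (t - 1) n. supp x u \<subseteq> {..<l}}) \<and> length p \<le> j}"
    for t j l :: nat
  have "finite (P t j l)" for t j l
    unfolding P_def by (intro finite_lists_length_le finite_cartesian_product) (auto simp: B)
  \<comment> \<open>The sum dominates each of I's answers, and \<open>2 * l\<close> keeps
    \<open>b - l\<close> beyond both the answer and \<open>l\<close> when \<open>b\<close> is the
    end of the interval.\<close>
  define \<beta> where "\<beta> j l = Suc (2 * l) + (\<Sum>t\<le>C j l. \<Sum>p\<in>P t j l. \<sigma> t p)" for j l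
  have \<sigma>_le: "\<sigma> t p + 2 * l < \<beta> j l" if "t \<le> C j l" "p \<in> P t j l" for t p j l
  proof -
    have "\<sigma> t p \<le> (\<Sum>p\<in>P t j l. \<sigma> t p)"
      using \<open>finite (P t j l)\<close> that by (intro member_le_sum) auto
    also have "\<dots> \<le> (\<Sum>t\<le>C j l. \<Sum>p\<in>P t j l. \<sigma> t p)"
      using that by (intro member_le_sum) auto
    finally show ?thesis
      by (simp add: \<beta>_def)
  qed
  define a where "a = rec_nat 0 (\<lambda>j l. Suc (\<beta> j l))"
  define b where "b j = \<beta> j (a j)" for j
  have a_Suc: "a (Suc j) = Suc (b j)" for j
    by (simp add: a_def b_def)
  have a_less_b: "2 * a j < b j" for j
    by (simp add: b_def \<beta>_def)
  have "a j < a (Suc j)" for j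
    using a_less_b[of j] by (simp add: a_Suc)
  then have "strict_mono a"
    by (simp add: strict_mono_Suc_iff)
  then have a_ge: "j \<le> a j" and a_mono: "i \<le> j \<Longrightarrow> a i \<le> a j" and a_less_iff: "a i < a j \<longleftrightarrow> i < j" for i j
    by (simp_all add: strict_mono_imp_increasing strict_mono_less_eq strict_mono_less)
  define I where "I j = {a j..b j}" for j
  have "\<not> A_embeds A y (closed_span (x ` {n. n \<notin> (\<Union>i\<in>M. I i)}))" if "infinite M" for M
  proof
    define T where "T = {n. n \<notin> (\<Union>i\<in>M. I i)}"
    assume "A_embeds A y (closed_span (x ` {n. n \<notin> (\<Union>i\<in>M. I i)}))"
    then obtain u K where u: "u \<in> A" "\<And>n. u n \<in> closed_span (x ` T)" and K: "K \<ge> 1" "equiv_const K u y"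
      unfolding A_embeds_def equivalent_seqs_def seqs_in_def T_def by blast
    obtain j where j: "j \<in> M" "K \<le> j"
      using \<open>infinite M\<close> real_arch_simple[of K] unfolding infinite_nat_iff_unbounded_le by (meson of_nat_le_iff order_trans)
    define l where "l = a j"
    define S where "S = {b j - l..<b j} \<union> T \<inter> {b j<..}"
    define t where "t = C j l"
    have "1 \<le> t"
      using C_pos[of j l] by (simp add: t_def)
    obtain v where v: "v \<in> A" "\<And>n. v n \<in> closed_span (x ` S)"
      and vu: "\<And>k. equiv_upto (1 + 4 * basis_const * l) k v u"
    proof -
      have "l \<le> b j"
        using a_less_b[of j] by (simp add: l_def)
      moreover have "T \<inter> {l..b j} = {}"
        using j(1) by (auto simp: T_def I_def l_def)
      ultimately show ?thesis
        using relocate[OF x _ _ u] that unfolding S_def by blast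
    qed
    have vy: "equiv_upto t k v y" for k
    proof -
      have "equiv_upto ((1 + 4 * basis_const * l) * K) k v y"
        using vu K basis_const(1) by (intro equiv_upto_trans[OF vu]) (auto simp: equiv_const_iff_upto)
      moreover have "(1 + 4 * basis_const * l) * K \<le> real (1 + c * l) * real (Suc j)"
        using c K j basis_const(1) by (intro mult_mono) (auto simp: mult_right_mono)
      moreover have "\<dots> = real t"
        unfolding t_def C_def of_nat_mult by (rule mult.commute)
      ultimately show ?thesis
        using equiv_upto_mono_const by metis
    qed
    have v_span: "v n \<in> closed_span (range x)" for n
      using v(2) closed_span_mono[of "x ` S" "range x"] by blast
    have v_norm: "1 / real (Suc (t - 1)) \<le> norm (v n) \<and> norm (v n) \<le> real (Suc (t - 1))" for n
      using equiv_upto_norm[OF vy] yb(3) \<open>1 \<le> t\<close> by simp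
    obtain w where w: "w \<in> A" "\<And>n. w n \<in> closed_span (range x)" "\<And>n. w n \<in> B (t - 1) n"
      "\<And>n. supp x (w n) \<subseteq> supp x (v n)" "\<And>n. norm (v n - w n) < \<delta> (t - 1) n"
      using net[OF v(1), of "t - 1"] v_span v_norm by blast
    have wy: "equiv_upto (2 * t) k w y" for k
    proof -
      have "norm (v n - w n) \<le> (1/2)^Suc n / (4 * basis_const * t)" for n
        using w(5)[of n] \<open>1 \<le> t\<close> unfolding \<delta>_def by (simp add: less_imp_le)
      then show ?thesis
        using equiv_upto_perturb[OF yb(1) yb(3) vy, of w] \<open>1 \<le> t\<close> by simp
    qed
    have w_supp: "supp x (w n) \<subseteq> S" for n
      using w(4)[of n] supp_closed_span_image[OF xb(1) v(2)[of n]] by blast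
    have "\<exists>m. supp x (w n) \<subseteq> {..<m}" for n
      using closed_span_supp_bounded[OF xb(1) A_in_D[OF w(1)] w(2)] by metis
    then obtain m where m: "\<And>n. supp x (w n) \<subseteq> {..<m n}"
      by metis
    \<comment> \<open>The avoided intervals with numbers \<open>J k\<close> separate II's moves:
      \<open>w k\<close> is supported before the one with number \<open>J (Suc k)\<close>, and
      \<open>k < J (Suc k)\<close> controls the length of positions.\<close>
    have "\<exists>J. J 0 = j \<and> (\<forall>k. J (Suc k) \<in> M \<and> J k < J (Suc k) \<and> k < J (Suc k) \<and> m k \<le> J (Suc k))"
    proof -
      have "\<exists>i. i \<in> M \<and> n < i \<and> k < i \<and> m k \<le> i" for n k
        using \<open>infinite M\<close> unfolding infinite_nat_iff_unbounded by (metis max_less_iff_conj less_imp_le)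
      then obtain f where f: "\<And>n k. f n k \<in> M \<and> n < f n k \<and> k < f n k \<and> m k \<le> f n k"
        by metis
      show ?thesis
        by (rule exI[of _ "rec_nat j (\<lambda>k n. f n k)"]) (use f in auto)
    qed
    then obtain J where J0: "J 0 = j" and J: "\<And>k. J (Suc k) \<in> M" "\<And>k. J k < J (Suc k)" "\<And>k. k < J (Suc k)" "\<And>k. m k \<le> J (Suc k)"
      by metis
    have J_mono: "strict_mono J"
      using J(2) by (simp add: strict_mono_Suc_iff)
    have JM: "J k \<in> M" for k
      by (cases k) (simp_all add: J0 j(1) J(1))
    have J_ge: "k \<le> J k" for k
      by (cases k) (simp_all add: J(3) Suc_leI)
    \<comment> \<open>The blocks of \<open>S\<close> from the start of one chosen interval to the
      start of the next. For \<open>k > 0\<close> that interval is avoided, and for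
      \<open>k = 0\<close> the set \<open>S\<close> begins at \<open>b j - l\<close> or later;
      either way the blocks lie beyond I's answer.\<close>
    define E where "E k = x ` {i \<in> S. a (J k) \<le> i \<and> i < a (J (Suc k))}" for k
    define r where "r k = (E k, w k)" for k
    have S_ge: "b j - l \<le> i" if "i \<in> S" for i
      using that by (auto simp: S_def)
    have S_ge_a: "a j \<le> i" if "i \<in> S" for i
      using S_ge[OF that] a_less_b[of j] by (simp add: l_def)
    have w_supp_less: "supp x (w n) \<subseteq> {..<a (J (Suc n))}" for n
      using m[of n] J(4)[of n] a_ge[of "J (Suc n)"] by fastforce
    have pool: "pool (map r [0..<k]) = x ` {i \<in> S. i < a (J k)}" for k
    proof (induction k)
      case 0
      then show ?case
        using S_ge_a by (auto simp: pool_def J0 leD)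
    next
      case (Suc k)
      have "a (J k) \<le> a (J (Suc k))"
        using J(2) a_mono less_imp_le by blast
      then have "{i \<in> S. i < a (J (Suc k))} = {i \<in> S. i < a (J k)} \<union> {i \<in> S. a (J k) \<le> i \<and> i < a (J (Suc k))}"
        by auto
      moreover have "pool (map r [0..<Suc k]) = pool (map r [0..<k]) \<union> E k"
        by (auto simp: pool_def r_def)
      ultimately show ?case
        using Suc by (simp add: E_def image_Un)
    qed
    have position: "map r [0..<k] \<in> P t (J k) (a (J k))" for k
    proof -
      have "r i \<in> Pow (x ` {..<a (J k)}) \<times> (\<Union>n<J k. {u \<in> B (t - 1) n. supp x u \<subseteq> {..<a (J k)}})" if "i < k" for i
      proof -
        have "J (Suc i) \<le> J k"
          using J_mono that by (simp add: strict_mono_less_eq)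
        then have "a (J (Suc i)) \<le> a (J k)"
          by (rule a_mono)
        moreover have "i < J k"
          using J_ge[of k] that by simp
        ultimately show ?thesis
          using w(3)[of i] w_supp_less[of i] unfolding r_def E_def by fastforce
      qed
      then have "set (map r [0..<k]) \<subseteq> Pow (x ` {..<a (J k)}) \<times> (\<Union>n<J k. {u \<in> B (t - 1) n. supp x u \<subseteq> {..<a (J k)}})"
        unfolding set_map image_subset_iff by simp
      then show ?thesis
        using J_ge[of k] unfolding P_def by simp
    qed
    have "legal (real (2 * t)) y x (\<sigma> t (map r [0..<k])) (map r [0..<k]) (r k)" for k
    proof -
      let ?p = "map r [0..<k]"
      have "C j l \<le> C (J k) (a (J k))"
        using J_mono J0 a_mono by (intro C_mono) (auto simp: l_def strict_mono_less_eq)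
      then have bound: "\<sigma> t ?p + 2 * a (J k) < b (J k)"
        unfolding b_def by (intro \<sigma>_le position) (simp add: t_def)
      have "\<sigma> t ?p \<le> i" if i: "i \<in> S" "a (J k) \<le> i" for i
      proof (cases k)
        case 0
        then show ?thesis
          using bound S_ge[OF i(1)] by (simp add: J0 l_def)
      next
        case (Suc k')
        then have "j < J k"
          using J_mono J0 strict_monoD by fastforce
        then have "b j < a (J k)"
          using a_mono[of "Suc j" "J k"] a_Suc[of j] by simp
        then have "i \<notin> I (J k)"
          using i JM[of k] by (auto simp: S_def T_def)
        then show ?thesis
          using i bound by (auto simp: I_def)
      qed
      then have "supp e v \<subseteq> {\<sigma> t ?p..}" if "v \<in> E k" for v
        using that block_supp_ge[OF xb(1)] unfolding E_def by fastforce
      moreover have "w k \<in> span (pool ?p \<union> E k)"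
      proof -
        have "pool ?p \<union> E k = pool (map r [0..<Suc k])"
          by (auto simp: pool_def r_def)
        also have "\<dots> = x ` {i \<in> S. i < a (J (Suc k))}"
          by (rule pool)
        finally have "pool ?p \<union> E k = x ` {i \<in> S. i < a (J (Suc k))}" .
        moreover have "supp x (w k) \<subseteq> {i \<in> S. i < a (J (Suc k))}"
          using w_supp[of k] w_supp_less[of k] by auto
        ultimately show ?thesis
          using in_span_supp[OF xb(1) A_in_D[OF w(1)] w(2)] by simp
      qed
      moreover have "E k \<subseteq> D \<inter> closed_span (range x)"
        using xb(2) closed_span_superset[of "range x"] unfolding E_def by blast
      moreover have ws: "map snd (?p @ [r k]) = map w [0..<Suc k]"
        by (simp add: r_def comp_def)
      have "equiv_upto (real (2 * t)) (Suc k) ((!) (map w [0..<Suc k])) y"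
        using wy[of "Suc k"] by (rule equiv_upto_cong) (simp_all del: upt_Suc)
      ultimately show ?thesis
        unfolding legal_def ws using initial_segmentI[OF w(1)] by (simp add: r_def E_def del: upt_Suc)
    qed
    then show False
      using \<sigma> by blast
  qed
  moreover have "successive_intervals I"
    unfolding successive_intervals_def
  proof (intro conjI allI)
    have a_b: "a i < b i" for i
      using a_less_b[of i] by simp
    show "\<exists>m n. m < n \<and> I i = {m..n}" for i
      using a_b[of i] unfolding I_def by blast
    have "Max (I i) = b i" "Min (I i) = a i" for i
      using a_b[of i] unfolding I_def by (auto intro: Max_eqI Min_eqI)
    then show "Max (I i) < Min (I (Suc i))" for i
      by (simp add: a_Suc)
  qed
  ultimately show ?thesis
    unfolding A_tight_in_def by blast
qed

subsection \<open>Fusion\<close>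

text \<open>With \<open>m\<close> past the supports of the finitely many exceptional
  \<open>x i\<close>, a block beyond \<open>m\<close> expands only in the others. Moves played far
  out thus transfer between spaces.\<close>

lemma almost_sub_beyond:
  assumes "block_subspace e D x" "almost_sub x z"
  obtains m where "\<And>v. v \<in> D \<Longrightarrow> v \<in> closed_span (range x) \<Longrightarrow> supp e v \<subseteq> {m..} \<Longrightarrow> v \<in> closed_span (range z)"
proof -
  note xb = block_subspaceD[OF assms(1)]
  obtain N where N: "\<And>n. n \<ge> N \<Longrightarrow> x n \<in> closed_span (range z)"
    using assms(2) by (auto simp: almost_sub_def)
  define m where "m = Suc (\<Sum>i<N. last_supp x i)"
  show thesis
  proof (rule that[of m])
    fix v assume v: "v \<in> D" "v \<in> closed_span (range x)" "supp e v \<subseteq> {m..}"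
    have "supp x v \<subseteq> {N..}"
    proof
      fix i assume "i \<in> supp x v"
      then have "last_supp x i \<in> supp e v"
        by (auto simp: supp_def coords_block[OF xb(1) v(2)] block_coeff_def)
      then have "m \<le> last_supp x i"
        using v(3) by auto
      moreover have "last_supp x i < m" if "i < N"
        using member_le_sum[of i "{..<N}" "last_supp x"] that by (simp add: m_def)
      ultimately show "i \<in> {N..}"
        by force
    qed
    then have "v \<in> span (x ` {N..})"
      using in_span_supp[OF xb(1) v(1,2)] by blast
    moreover have "x ` {N..} \<subseteq> closed_span (range z)"
      using N by auto
    ultimately show "v \<in> closed_span (range z)"
      using span_subset_closed_span by blast
  qed
qed

lemma almost_sub_trans:
  assumes "block_subspace e D y" "block_subspace e D x" "almost_sub y x" "almost_sub x z"
  shows "almost_sub y z"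
proof -
  note yb = block_subspaceD[OF assms(1)]
  obtain m where m: "\<And>v. v \<in> D \<Longrightarrow> v \<in> closed_span (range x) \<Longrightarrow> supp e v \<subseteq> {m..} \<Longrightarrow> v \<in> closed_span (range z)"
    using almost_sub_beyond assms(2,4) by blast
  obtain N where N: "\<And>n. n \<ge> N \<Longrightarrow> y n \<in> closed_span (range x)"
    using assms(3) by (auto simp: almost_sub_def)
  have "y n \<in> closed_span (range z)" if "n \<ge> max N m" for n
  proof (rule m)
    show "supp e (y n) \<subseteq> {m..}"
      using block_supp_ge[OF yb(1)] that by fastforce
  qed (use yb N that in auto)
  then show ?thesis
    unfolding almost_sub_def by blast
qed

text \<open>The \<open>k\<close>-th term comes from \<open>Z k\<close>, far enough out to lie in the
  spans of all earlier \<open>Z m\<close> and beyond the previous term.\<close>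

lemma diagonal_subspace:
  assumes Z: "\<And>n. block_subspace e D (Z n)" and dec: "\<And>n. almost_sub (Z (Suc n)) (Z n)"
  shows "\<exists>x. block_subspace e D x \<and> (\<forall>n. almost_sub x (Z n))"
proof -
  have "almost_sub (Z n) (Z m)" if "m \<le> n" for m n
    using that
  proof (induction rule: dec_induct)
    case base
    show ?case
      by (rule almost_sub_refl)
  next
    case (step n)
    then show ?case
      using almost_sub_trans[OF Z Z dec] by blast
  qed
  then have "\<exists>N. \<forall>i\<ge>N. Z k i \<in> closed_span (range (Z m))" if "m \<le> k" for m k
    using that by (auto simp: almost_sub_def)
  then obtain N where N: "\<And>m k i. m \<le> k \<Longrightarrow> i \<ge> N m k \<Longrightarrow> Z k i \<in> closed_span (range (Z m))"
    by metis
  define P where "P k v \<longleftrightarrow> v \<in> range (Z k) \<and> (\<forall>m\<le>k. v \<in> closed_span (range (Z m)))" for k v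
  have far: "\<exists>v. P k v \<and> supp e v \<subseteq> {l..}" for k l
  proof -
    define i where "i = l + (\<Sum>m\<le>k. N m k)"
    have "N m k \<le> i" if "m \<le> k" for m
      using member_le_sum[of m "{..k}" "\<lambda>m. N m k"] that by (simp add: i_def)
    then have "P k (Z k i)"
      using N by (simp add: P_def)
    moreover have "supp e (Z k i) \<subseteq> {l..}"
      using block_supp_ge[OF block_subspaceD(1)[OF Z]] by (fastforce simp: i_def)
    ultimately show ?thesis
      by blast
  qed
  have PD: "v \<in> D" "norm v = 1" if "P k v" for k v
    using that block_subspaceD(2,3)[OF Z] by (auto simp: P_def)
  have "\<exists>x. \<forall>k. P k (x k) \<and> before e (x k) (x (Suc k))"
  proof (rule dependent_nat_choice)
    show "\<exists>v. P 0 v"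
      using far by blast
    fix v k assume "P k v"
    then obtain l where l: "supp e v \<subseteq> {..<l}"
      using PD finite_supp_D finite_nat_iff_bounded by metis
    obtain v' where "P (Suc k) v'" "supp e v' \<subseteq> {l..}"
      using far by blast
    then show "\<exists>v'. P (Suc k) v' \<and> before e v v'"
      using l by (fastforce simp: before_def)
  qed
  then obtain x where x: "\<And>k. P k (x k)" "\<And>k. before e (x k) (x (Suc k))"
    by blast
  have "x n \<noteq> 0" for n
    using PD(2)[OF x(1)[of n]] by auto
  then have "block_subspace e D x"
    using x(2) PD[OF x(1)] finite_supp_D
    by (simp add: block_subspace_def block_seq_def block_basis_def normalized_def)
  moreover have "almost_sub x (Z n)" for n
    using x(1) by (auto simp: almost_sub_def P_def)
  ultimately show ?thesis
    by blast
qed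

text \<open>The countably many requirements are met one at a time along a decreasing sequence. As
  they are hereditary, a diagonal subspace meets them all.\<close>

lemma fusion:
  assumes "countable S" and x: "block_subspace e D x"
    and down: "\<And>s y z. s \<in> S \<Longrightarrow> block_subspace e D y \<Longrightarrow> block_subspace e D z \<Longrightarrow> almost_sub y z \<Longrightarrow> Q s z \<Longrightarrow> Q s y"
    and dense: "\<And>s z. s \<in> S \<Longrightarrow> block_subspace e D z \<Longrightarrow> almost_sub z x \<Longrightarrow> \<exists>y. block_subspace e D y \<and> almost_sub y z \<and> Q s y"
  shows "\<exists>y. block_subspace e D y \<and> almost_sub y x \<and> (\<forall>s\<in>S. Q s y)"
proof (cases "S = {}")
  case True
  then show ?thesis
    using x almost_sub_refl by auto
next
  case False
  define s where "s = from_nat_into S"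
  have s: "s n \<in> S" for n
    using False by (simp add: s_def from_nat_into)
  define P where "P z \<longleftrightarrow> block_subspace e D z \<and> almost_sub z x" for z
  have "\<exists>Z. \<forall>n. P (Z n) \<and> almost_sub (Z (Suc n)) (Z n) \<and> Q (s n) (Z (Suc n))"
  proof (rule dependent_nat_choice)
    show "\<exists>z. P z"
      using x almost_sub_refl by (auto simp: P_def)
    fix z n assume "P z"
    then obtain y where y: "block_subspace e D y" "almost_sub y z" "Q (s n) y"
      using dense[OF s] by (auto simp: P_def)
    then have "P y"
      using \<open>P z\<close> almost_sub_trans by (auto simp: P_def)
    then show "\<exists>y. P y \<and> almost_sub y z \<and> Q (s n) y"
      using y by blast
  qed
  then obtain Z where Z: "\<And>n. P (Z n)" "\<And>n. almost_sub (Z (Suc n)) (Z n)" "\<And>n. Q (s n) (Z (Suc n))"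
    by blast
  then obtain y where y: "block_subspace e D y" "\<And>n. almost_sub y (Z n)"
    using diagonal_subspace[of Z] by (auto simp: P_def)
  have "almost_sub y x"
    using almost_sub_trans[OF y(1) _ y(2)] Z(1)[of 0] by (auto simp: P_def)
  moreover have "Q t y" if "t \<in> S" for t
  proof -
    obtain n where "s n = t"
      using from_nat_into_surj[OF \<open>countable S\<close> \<open>t \<in> S\<close>] by (auto simp: s_def)
    then show ?thesis
      using down[OF s y(1) _ y(2) Z(3)] Z(1) by (auto simp: P_def)
  qed
  ultimately show ?thesis
    using y(1) by blast
qed

text \<open>Below any \<open>z\<close>, either some \<open>y\<close> fails \<open>\<Phi> s\<close>
  or \<open>\<Phi> s\<close> holds everywhere. By monotonicity either outcome persists downwards, so
  fusion decides all \<open>s\<close> at once.\<close>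

lemma stabilise:
  assumes "countable S" "block_subspace e D x"
    and mono: "\<And>s y z. block_subspace e D y \<Longrightarrow> block_subspace e D z \<Longrightarrow> almost_sub y z \<Longrightarrow> \<Phi> s y \<Longrightarrow> \<Phi> s z"
  shows "\<exists>y. block_subspace e D y \<and> almost_sub y x \<and>
    (\<forall>s\<in>S. \<Phi> s y \<longrightarrow> (\<forall>z. block_subspace e D z \<longrightarrow> almost_sub z y \<longrightarrow> \<Phi> s z))"
  using assms(1,2)
proof (rule fusion)
  fix s z
  assume "block_subspace e D z"
  then show "\<exists>y. block_subspace e D y \<and> almost_sub y z \<and>
      (\<Phi> s y \<longrightarrow> (\<forall>z. block_subspace e D z \<longrightarrow> almost_sub z y \<longrightarrow> \<Phi> s z))"
    using almost_sub_refl by metis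
next
  fix s y z
  assume "block_subspace e D y" "block_subspace e D z" "almost_sub y z"
    and "\<Phi> s z \<longrightarrow> (\<forall>z'. block_subspace e D z' \<longrightarrow> almost_sub z' z \<longrightarrow> \<Phi> s z')"
  then show "\<Phi> s y \<longrightarrow> (\<forall>z. block_subspace e D z \<longrightarrow> almost_sub z y \<longrightarrow> \<Phi> s z)"
    using mono almost_sub_trans by blast
qed

lemma countable_D: "countable D"
proof -
  have "countable F"
    using scalars by (simp add: scalar_field_def)
  have "rational_vectors e F \<subseteq> (\<lambda>(S, l). \<Sum>n\<in>S. l ! n *\<^sub>R e n) ` ({S. finite S} \<times> lists F)"
  proof
    fix u assume "u \<in> rational_vectors e F"
    then obtain S a where S: "finite S" "\<forall>n\<in>S. a n \<in> F" "u = (\<Sum>n\<in>S. a n *\<^sub>R e n)"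
      unfolding rational_vectors_def by blast
    obtain m where m: "S \<subseteq> {..<m}"
      using S(1) finite_nat_iff_bounded by blast
    have "0 \<in> F"
      using scalars by (simp add: scalar_field_def real_subfield_def)
    define l where "l = map (\<lambda>n. if n \<in> S then a n else 0) [0..<m]"
    have "l \<in> lists F"
      using S(2) \<open>0 \<in> F\<close> by (auto simp: l_def in_lists_conv_set)
    moreover have "u = (\<Sum>n\<in>S. l ! n *\<^sub>R e n)"
      unfolding S(3) using m by (intro sum.cong) (auto simp: l_def)
    ultimately show "u \<in> (\<lambda>(S, l). \<Sum>n\<in>S. l ! n *\<^sub>R e n) ` ({S. finite S} \<times> lists F)"
      using S(1) by (auto intro!: image_eqI[of _ _ "(S, l)"])
  qed
  moreover have "countable ({S :: nat set. finite S} \<times> lists F)"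
    using \<open>countable F\<close> countable_Collect_finite by blast
  ultimately show ?thesis
    by (meson D_rational countable_image countable_subset order_trans)
qed

text \<open>I raises every number of the strategy for \<open>z'\<close> to at least
  \<open>m\<close>; then each legal answer in \<open>z\<close> is one in \<open>z'\<close>.\<close>

lemma I_wins_almost_sub:
  assumes "block_subspace e D z" "almost_sub z z'" "I_wins C y z' p"
  shows "I_wins C y z p"
proof -
  obtain m where m: "\<And>v. v \<in> D \<Longrightarrow> v \<in> closed_span (range z) \<Longrightarrow> supp e v \<subseteq> {m..} \<Longrightarrow> v \<in> closed_span (range z')"
    using almost_sub_beyond assms(1,2) by blast
  obtain \<sigma> where \<sigma>: "\<And>r. \<exists>k. \<not> legal C y z' (\<sigma> (p @ map r [0..<k])) (p @ map r [0..<k]) (r k)"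
    using assms(3) unfolding I_wins_def by blast
  have "legal C y z' n p q" if "legal C y z (max n m) p q" for n p q
  proof -
    have "v \<in> closed_span (range z')" "supp e v \<subseteq> {n..}" if "v \<in> fst q" for v
    proof -
      have v: "v \<in> D" "v \<in> closed_span (range z)" "supp e v \<subseteq> {max n m..}"
        using \<open>legal C y z (max n m) p q\<close> that by (auto simp: legal_def)
      then have "supp e v \<subseteq> {m..}"
        by auto
      then show "v \<in> closed_span (range z')"
        using m v by blast
      show "supp e v \<subseteq> {n..}"
        using v(3) by auto
    qed
    then show ?thesis
      using that unfolding legal_def by blast
  qed
  then show ?thesis
    unfolding I_wins_def by (intro exI[of _ "\<lambda>p. max (\<sigma> p) m"]) (metis \<sigma>)
qed

subsection \<open>The copying game\<close>

lemma block_subspace_basis: "block_subspace e D e"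
proof -
  have supp_e: "supp e (e n) = {n}" for n
    by (auto simp: supp_def coords_basis)
  have "e n \<noteq> 0" for n
    using norm_e[of n] by force
  then show ?thesis
    using e_in_D normalized_basis
    by (simp add: block_subspace_def block_seq_def block_basis_def before_def supp_e)
qed

lemma pool_append: "pool (p @ q) = pool p \<union> pool q"
  by (auto simp: pool_def)

lemma pool_Nil: "pool [] = {}"
  by (simp add: pool_def)

lemma pool_single: "pool [q] = fst q"
  by (simp add: pool_def)

text \<open>\<open>I_wins\<close> does not tell how \<open>p\<close> arose, so the invariants of a
  position reached by legal moves are recorded too.\<close>

definition II_survives :: "real \<Rightarrow> (nat \<Rightarrow> 'a) \<Rightarrow> (nat \<Rightarrow> 'a) \<Rightarrow> ('a set \<times> 'a) list \<Rightarrow> bool" where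
  "II_survives C y z p \<longleftrightarrow>
     \<not> I_wins C y z p \<and> finite (pool p) \<and> pool p \<subseteq> D \<inter> closed_span (range z) \<and>
     initial_segment A (map snd p) \<and> equiv_upto C (length p) ((!) (map snd p)) y \<and>
     snd ` set p \<subseteq> span (pool p)"

lemma II_survives_Nil:
  assumes "\<not> I_wins C y z []"
  shows "II_survives C y z []"
  using assms block_subspaceD(5)[OF block_subspace_basis]
  by (auto simp: II_survives_def pool_Nil initial_segment_def equiv_upto_def)

lemma II_survives_move:
  assumes "II_survives C y z p"
  shows "\<exists>q. legal C y z n p q \<and> II_survives C y z (p @ [q])"
proof -
  obtain q where q: "legal C y z n p q" "\<not> I_wins C y z (p @ [q])"
    using assms not_I_wins_move[of C y z p n] unfolding II_survives_def by blast
  have "span (pool p) \<subseteq> span (pool p \<union> fst q)"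
    by (intro span_mono) auto
  then have "II_survives C y z (p @ [q])"
    using assms q unfolding II_survives_def legal_def pool_append pool_single by auto
  then show ?thesis
    using q by blast
qed

text \<open>I repeats the number \<open>n\<close>. This gives II as many terms beyond
  \<open>n\<close> as a copied vector needs.\<close>

lemma II_survives_moves:
  assumes "II_survives C y z p"
  shows "\<exists>q. length q = k \<and> II_survives C y z (p @ q) \<and> (\<forall>v\<in>pool q. supp e v \<subseteq> {n..})"
proof (induction k)
  case 0
  show ?case
    using assms by (intro exI[of _ "[]"]) (simp add: pool_Nil)
next
  case (Suc k)
  then obtain q where q: "length q = k" "II_survives C y z (p @ q)" "\<forall>v\<in>pool q. supp e v \<subseteq> {n..}"
    by blast
  obtain q' where "legal C y z n (p @ q) q'" "II_survives C y z ((p @ q) @ [q'])"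
    using II_survives_move[OF q(2)] by blast
  then show ?case
    using q by (intro exI[of _ "q @ [q']"]) (auto simp: pool_append pool_single legal_def)
qed

text \<open>The game in which player I builds a sequence in the space with basis \<open>y\<close> and player II copies it
  in the space with basis \<open>z\<close>.  A position consists of the sets of blocks available to I and II and of
  the vectors played so far.\<close>

type_synonym 'b position = "'b set \<times> 'b set \<times> 'b list \<times> 'b list"

definition I_move :: "(nat \<Rightarrow> 'a) \<Rightarrow> 'a position \<Rightarrow> 'a set \<Rightarrow> 'a \<Rightarrow> bool" where
  "I_move y s F' v \<longleftrightarrow> (case s of (Fp, Ep, vs, ws) \<Rightarrow>
     finite F' \<and> F' \<subseteq> D \<inter> closed_span (range y) \<and> v \<in> span (Fp \<union> F') \<and> initial_segment A (vs @ [v]))"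

definition II_move :: "real \<Rightarrow> (nat \<Rightarrow> 'a) \<Rightarrow> nat \<Rightarrow> 'a position \<Rightarrow> 'a \<Rightarrow> 'a set \<Rightarrow> 'a \<Rightarrow> bool" where
  "II_move C z n s v E' w \<longleftrightarrow> (case s of (Fp, Ep, vs, ws) \<Rightarrow>
     finite E' \<and> E' \<subseteq> D \<inter> closed_span (range z) \<and> (\<forall>u\<in>E'. supp e u \<subseteq> {n..}) \<and>
     w \<in> span (Ep \<union> E') \<and> initial_segment A (ws @ [w]) \<and>
     equiv_upto C (Suc (length vs)) ((!) (ws @ [w])) ((!) (vs @ [v])))"

fun next_pos :: "'a position \<Rightarrow> 'a set \<Rightarrow> 'a \<Rightarrow> 'a set \<Rightarrow> 'a \<Rightarrow> 'a position" where
  "next_pos (Fp, Ep, vs, ws) F' v E' w = (Fp \<union> F', Ep \<union> E', vs @ [v], ws @ [w])"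

text \<open>A greatest fixed point, because II wins by being able to move forever.\<close>

coinductive II_wins :: "real \<Rightarrow> (nat \<Rightarrow> 'a) \<Rightarrow> (nat \<Rightarrow> 'a) \<Rightarrow> 'a position \<Rightarrow> bool"
  for C y z where
  II_winsI: "(\<forall>n F' v. I_move y s F' v \<longrightarrow>
      (\<exists>E' w. II_move C z n s v E' w \<and> II_wins C y z (next_pos s F' v E' w))) \<Longrightarrow> II_wins C y z s"

lemma II_move_almost_sub:
  assumes "block_subspace e D z" "almost_sub z z'"
  obtains m where "\<And>n s v E' w. II_move C z (max n m) s v E' w \<Longrightarrow> II_move C z' n s v E' w"
proof -
  obtain m where m: "\<And>v. v \<in> D \<Longrightarrow> v \<in> closed_span (range z) \<Longrightarrow> supp e v \<subseteq> {m..} \<Longrightarrow> v \<in> closed_span (range z')"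
    using almost_sub_beyond assms by blast
  show thesis
  proof (rule that)
    fix n s v E' w
    assume *: "II_move C z (max n m) s v E' w"
    obtain Fp Ep vs ws where s: "s = (Fp, Ep, vs, ws)"
      using prod_cases4 by blast
    have "u \<in> closed_span (range z')" "supp e u \<subseteq> {n..}" if "u \<in> E'" for u
    proof -
      have u: "u \<in> D" "u \<in> closed_span (range z)" "supp e u \<subseteq> {max n m..}"
        using * that by (auto simp: II_move_def s)
      then have "supp e u \<subseteq> {m..}"
        by auto
      then show "u \<in> closed_span (range z')"
        using m u by blast
      show "supp e u \<subseteq> {n..}"
        using u(3) by auto
    qed
    then show "II_move C z' n s v E' w"
      using * unfolding II_move_def s by blast
  qed
qed

lemma II_wins_almost_sub:
  assumes "block_subspace e D z" "almost_sub z z'" "II_wins C y z s"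
  shows "II_wins C y z' s"
proof -
  obtain m where m: "\<And>n s v E' w. II_move C z (max n m) s v E' w \<Longrightarrow> II_move C z' n s v E' w"
    using II_move_almost_sub assms(1,2) by blast
  show ?thesis
    using assms(3)
  proof (coinduction arbitrary: s)
    case II_wins
    then have "\<forall>n F' v. I_move y s F' v \<longrightarrow>
      (\<exists>E' w. II_move C z n s v E' w \<and> II_wins C y z (next_pos s F' v E' w))"
      by (cases rule: II_wins.cases)
    then show ?case
      using m by metis
  qed
qed

text \<open>II plays the asymptotic game on the side. To copy \<open>v\<close>, she extends
  \<open>p\<close> until it has a term for every coordinate of \<open>v\<close> in \<open>y\<close>,
  and substitutes these terms for \<open>y\<close>. The axiom on \<open>star\<close> gives
  admissibility, and equivalence with \<open>y\<close> passes to the copies.\<close>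

lemma II_wins_if_survives:
  assumes y: "block_subspace e D y" and "II_survives C y z p"
    and "Fp \<subseteq> closed_span (range y)" "length vs = length ws"
    and "\<And>i. i < length vs \<Longrightarrow> vs ! i \<in> closed_span (range y) \<and> supp y (vs ! i) \<subseteq> {..<length p} \<and>
           ws ! i = (\<Sum>j<length p. coords y (vs ! i) j *\<^sub>R map snd p ! j)"
  shows "II_wins C y z (Fp, pool p, vs, ws)"
proof -
  note yb = block_subspaceD[OF y]
  \<comment> \<open>The invariant of the simulation: each \<open>ws ! i\<close> is
    \<open>vs ! i\<close> with the terms of \<open>p\<close> in place of \<open>y\<close>.\<close>
  define Q where "Q s \<longleftrightarrow> (\<exists>Fp p vs ws. s = (Fp, pool p, vs, ws) \<and> II_survives C y z p \<and>
      Fp \<subseteq> closed_span (range y) \<and> length vs = length ws \<and>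
      (\<forall>i<length vs. vs ! i \<in> closed_span (range y) \<and> supp y (vs ! i) \<subseteq> {..<length p} \<and>
           ws ! i = (\<Sum>j<length p. coords y (vs ! i) j *\<^sub>R map snd p ! j)))" for s
  have step: "\<exists>E' w. II_move C z n s v E' w \<and> Q (next_pos s F' v E' w)"
    if "Q s" and "I_move y s F' v" for s n F' v
  proof -
    obtain Fp p vs ws where s: "s = (Fp, pool p, vs, ws)" and p: "II_survives C y z p"
      and Fp: "Fp \<subseteq> closed_span (range y)" and len: "length vs = length ws"
      and vs: "\<And>i. i < length vs \<Longrightarrow> vs ! i \<in> closed_span (range y)"
        "\<And>i. i < length vs \<Longrightarrow> supp y (vs ! i) \<subseteq> {..<length p}"
      and ws: "\<And>i. i < length vs \<Longrightarrow> ws ! i = (\<Sum>j<length p. coords y (vs ! i) j *\<^sub>R map snd p ! j)"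
      using \<open>Q s\<close> unfolding Q_def by blast
    have F': "F' \<subseteq> closed_span (range y)" "v \<in> span (Fp \<union> F')" "initial_segment A (vs @ [v])"
      using \<open>I_move y s F' v\<close> by (auto simp: I_move_def s)
    have v: "v \<in> closed_span (range y)"
      using span_subset_closed_span[of "Fp \<union> F'" "range y"] Fp F' by blast
    define k where "k = length vs"
    obtain v0 where v0: "v0 \<in> A" "\<And>i. i < Suc k \<Longrightarrow> (vs @ [v]) ! i = v0 i"
      using F'(3) by (auto simp: initial_segment_def k_def)
    obtain v' where v': "v' \<in> A" "\<And>i. i \<le> k \<Longrightarrow> v' i = v0 i" "\<And>i. i > k \<Longrightarrow> v' i \<in> closed_span (range y)"
      using A_extend[OF yb(4) v0(1)] by metis
    have v'_eq: "v' i = (vs @ [v]) ! i" if "i < Suc k" for i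
      using v0(2)[OF that] v'(2)[of i] that by simp
    have v'_span: "v' i \<in> closed_span (range y)" for i
    proof (cases "i < Suc k")
      case True
      then show ?thesis
        using v'_eq[of i] vs(1)[of i] v by (cases "i < k") (auto simp: nth_append k_def less_Suc_eq)
    qed (use v'(3) in auto)
    have v'_D: "v' i \<in> D" for i
      using A_in_D v'(1) .
    obtain m where m: "supp y (v' k) \<subseteq> {..<m}"
      using closed_span_supp_bounded[OF yb(1) v'_D v'_span] .
    obtain q where q: "length q = m" "II_survives C y z (p @ q)" "\<forall>v\<in>pool q. supp e v \<subseteq> {n..}"
      using II_survives_moves[OF p] by blast
    define N where "N = length (p @ q)"
    obtain u where u: "u \<in> A" "\<And>i. i < N \<Longrightarrow> map snd (p @ q) ! i = u i"
      using q(2) by (auto simp: II_survives_def initial_segment_def N_def simp del: map_append)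
    have supp_v': "supp y (v' i) \<subseteq> {..<N}" if "i < Suc k" for i
    proof (cases "i = k")
      case True
      then show ?thesis
        using m q(1) by (auto simp: N_def)
    next
      case False
      then show ?thesis
        using vs(2)[of i] v'_eq[OF that] that by (auto simp: N_def k_def nth_append)
    qed
    \<comment> \<open>For \<open>i \<le> k\<close> only terms of \<open>u\<close> below
      \<open>N\<close> enter \<open>w' i\<close>, and these are the moves made by II.\<close>
    define w' where "w' = star y v' u"
    have "w' \<in> A"
      unfolding w'_def using star_in_A_iff[OF u(1) y v'_D v'_span] v'(1) by simp
    have w'_sum: "w' i = (\<Sum>j<N. coords y (v' i) j *\<^sub>R map snd (p @ q) ! j)" if "i < Suc k" for i
    proof -
      have "w' i = (\<Sum>j<N. coords y (v' i) j *\<^sub>R u j)"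
        unfolding w'_def using supp_v'[OF that] by (rule star_eq[of y v' i])
      then show ?thesis
        using u(2) by simp
    qed
    have w'_eq: "w' i = (ws @ [w' k]) ! i" if "i < Suc k" for i
    proof (cases "i = k")
      case False
      then have i: "i < length vs"
        using that by (simp add: k_def)
      have "ws ! i = (\<Sum>j<N. coords y (vs ! i) j *\<^sub>R map snd (p @ q) ! j)"
        unfolding ws[OF i]
        by (rule sum.mono_neutral_cong_left) (use vs(2)[OF i] in \<open>auto simp: N_def supp_def nth_append\<close>)
      then show ?thesis
        using w'_sum[OF that] v'_eq[OF that] i len by (simp add: nth_append)
    qed (simp add: k_def len nth_append)
    have w'_span: "w' k \<in> span (pool p \<union> pool q)"
    proof -
      have "map snd (p @ q) ! j \<in> span (pool (p @ q))" if "j < N" for j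
        using q(2) that unfolding II_survives_def N_def by (metis image_set length_map nth_mem subsetD)
      then show ?thesis
        unfolding w'_sum[OF lessI] pool_append by (intro span_sum span_scale) auto
    qed
    have equiv: "equiv_upto C (Suc k) w' v'"
      unfolding equiv_upto_def
    proof
      fix a :: "nat \<Rightarrow> real"
      define c where "c j = (\<Sum>n<Suc k. a n * coords y (v' n) j)" for j
      have "star y v' y n = v' n" for n
        by (rule star_self[OF yb(1) v'_span finite_supp_D[OF v'_D]])
      then have "(\<Sum>n<Suc k. a n *\<^sub>R v' n) = (\<Sum>j<N. c j *\<^sub>R y j)"
        using sum_star[where x = y and v = v' and u = y and N = N and k = "Suc k" and a = a] supp_v'
        by (simp add: c_def)
      moreover have "(\<Sum>n<Suc k. a n *\<^sub>R w' n) = (\<Sum>j<N. c j *\<^sub>R u j)"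
        unfolding w'_def c_def by (rule sum_star[OF supp_v'])
      moreover have "equiv_upto C N ((!) (map snd (p @ q))) y"
        using q(2) unfolding II_survives_def N_def by blast
      then have "equiv_upto C N u y"
        by (rule equiv_upto_cong) (simp_all only: u(2))
      ultimately show "norm (\<Sum>n<Suc k. a n *\<^sub>R w' n) \<le> C * norm (\<Sum>n<Suc k. a n *\<^sub>R v' n) \<and>
          norm (\<Sum>n<Suc k. a n *\<^sub>R v' n) \<le> C * norm (\<Sum>n<Suc k. a n *\<^sub>R w' n)"
        unfolding equiv_upto_def by simp
    qed
    have "II_move C z n s v (pool q) (w' k)"
      unfolding II_move_def s prod.case
    proof (intro conjI)
      show "finite (pool q)" "pool q \<subseteq> D \<inter> closed_span (range z)"
        using q(2) by (auto simp: II_survives_def pool_append)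
      show "initial_segment A (ws @ [w' k])"
        unfolding initial_segment_def
        by (rule bexI[OF _ \<open>w' \<in> A\<close>]) (simp add: len[symmetric] k_def[symmetric] w'_eq[symmetric])
      show "equiv_upto C (Suc (length vs)) ((!) (ws @ [w' k])) ((!) (vs @ [v]))"
        using equiv unfolding k_def[symmetric] by (rule equiv_upto_cong) (simp_all add: w'_eq[symmetric] v'_eq)
    qed (use q(3) w'_span in auto)
    moreover have "Q (next_pos s F' v (pool q) (w' k))"
      unfolding Q_def
    proof (intro exI conjI allI impI)
      show "next_pos s F' v (pool q) (w' k) = (Fp \<union> F', pool (p @ q), vs @ [v], ws @ [w' k])"
        by (simp add: s pool_append)
      fix i assume "i < length (vs @ [v])"
      then have i: "i < Suc k"
        by (simp add: k_def)
      show "(vs @ [v]) ! i \<in> closed_span (range y)" "supp y ((vs @ [v]) ! i) \<subseteq> {..<length (p @ q)}"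
        unfolding v'_eq[OF i, symmetric] N_def[symmetric] by (rule v'_span, rule supp_v'[OF i])
      show "(ws @ [w' k]) ! i = (\<Sum>j<length (p @ q). coords y ((vs @ [v]) ! i) j *\<^sub>R map snd (p @ q) ! j)"
        unfolding v'_eq[OF i, symmetric] w'_eq[OF i, symmetric] N_def[symmetric] by (rule w'_sum[OF i])
    qed (use Fp F' len q in auto)
    ultimately show ?thesis
      by blast
  qed
  have "II_wins C y z s" if "Q s" for s
    using that
  proof (coinduction arbitrary: s)
    case II_wins
    then have "\<forall>n F' v. I_move y s F' v \<longrightarrow> (\<exists>E' w. II_move C z n s v E' w \<and> Q (next_pos s F' v E' w))"
      using step by metis
    then show ?case
      by metis
  qed
  moreover have "Q (Fp, pool p, vs, ws)"
    unfolding Q_def using assms by blast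
  ultimately show ?thesis
    by blast
qed

section \<open>Uniform copying over countably many positions\<close>

definition positions :: "'a position set" where
  "positions = {S. finite S \<and> S \<subseteq> D} \<times> {S. finite S \<and> S \<subseteq> D} \<times> lists D \<times> lists D"

lemma countable_finite_subsets_D: "countable {S. finite S \<and> S \<subseteq> D}"
  using countable_Collect_finite_subset[OF countable_D] .

lemma countable_positions: "countable positions"
  unfolding positions_def by (intro countable_SIGMA countable_finite_subsets_D countable_lists countable_D)

lemma initial_segment_D: "initial_segment A us \<Longrightarrow> set us \<subseteq> D"
  using A_in_D by (auto simp: initial_segment_def in_set_conv_nth)

text \<open>Admissible vectors are blocks and pools stay finite, so play never leaves the countable
  set over which fusion runs.\<close>

lemma next_pos_positions:
  assumes "s \<in> positions" "I_move y s F' v" "II_move C z n s v E' w"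
  shows "next_pos s F' v E' w \<in> positions"
proof -
  obtain Fp Ep vs ws where s: "s = (Fp, Ep, vs, ws)"
    using prod_cases4 by blast
  have "set (vs @ [v]) \<subseteq> D" "set (ws @ [w]) \<subseteq> D"
    using assms(2,3) by (simp_all only: initial_segment_D I_move_def II_move_def s prod.case)
  then show ?thesis
    using assms by (auto simp: I_move_def II_move_def s positions_def)
qed

text \<open>Exchanging the order of quantifiers: from one \<open>Y\<close> for every \<open>Z\<close> to one \<open>X\<close> for all \<open>Z\<close>.  The price
  is that player I has to play after a number \<open>m\<close> that depends on the position.\<close>

lemma uniform_copying:
  assumes x0: "block_subspace e D x0"
    and copies: "\<And>z. block_subspace e D z \<Longrightarrow> almost_sub z x0 \<Longrightarrow>
      \<exists>y. block_subspace e D y \<and> almost_sub y z \<and> II_wins C y z ({}, {}, [], [])"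
  obtains x G where "block_subspace e D x" "almost_sub x x0" "({}, {}, [], []) \<in> G"
    "\<And>s z. s \<in> G \<Longrightarrow> block_subspace e D z \<Longrightarrow> almost_sub z x \<Longrightarrow>
      \<exists>m. \<forall>F' v. I_move x s F' v \<longrightarrow> (\<forall>u\<in>F'. supp e u \<subseteq> {m..}) \<longrightarrow>
        (\<exists>E' w. II_move C z 0 s v E' w \<and> next_pos s F' v E' w \<in> G)"
proof -
  let ?bs = "block_subspace e D"
  \<comment> \<open>Here \<open>y\<close> still depends on \<open>z\<close>. After stabilisation, a
    position in \<open>G\<close> admits such a \<open>y\<close> in every \<open>z\<close> below
    \<open>x1\<close>.\<close>
  define \<Phi> where "\<Phi> s z \<longleftrightarrow> (\<exists>y. ?bs y \<and> almost_sub y z \<and> II_wins C y z s)" for s z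
  have \<Phi>_mono: "\<Phi> s z'" if "?bs z" "?bs z'" "almost_sub z z'" "\<Phi> s z" for s z z'
    using that almost_sub_trans II_wins_almost_sub unfolding \<Phi>_def by metis
  have "\<exists>x. ?bs x \<and> almost_sub x x0 \<and> (\<forall>s\<in>positions. \<Phi> s x \<longrightarrow> (\<forall>z. ?bs z \<longrightarrow> almost_sub z x \<longrightarrow> \<Phi> s z))"
    by (rule stabilise[OF countable_positions x0]) (rule \<Phi>_mono)
  then obtain x1 where x1: "?bs x1" "almost_sub x1 x0"
    and \<Phi>_stable: "\<And>s z. s \<in> positions \<Longrightarrow> \<Phi> s x1 \<Longrightarrow> ?bs z \<Longrightarrow> almost_sub z x1 \<Longrightarrow> \<Phi> s z"
    by blast
  define G where "G = {s \<in> positions. \<Phi> s x1}"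
  \<comment> \<open>An answer to one fixed move of I that keeps the play in \<open>G\<close>. Asking
    for it beyond every \<open>n\<close> makes \<open>\<Psi>\<close> monotone in \<open>z\<close>,
    hence open to stabilisation.\<close>
  define \<Psi> where "\<Psi> = (\<lambda>(s, F', v) z. \<forall>n. \<exists>E' w. II_move C z n s v E' w \<and> next_pos s F' v E' w \<in> G)"
  have \<Psi>_mono: "\<Psi> t z'" if "?bs z" "?bs z'" "almost_sub z z'" "\<Psi> t z" for t z z'
  proof -
    obtain m where m: "\<And>n s v E' w. II_move C z (max n m) s v E' w \<Longrightarrow> II_move C z' n s v E' w"
      using II_move_almost_sub[OF \<open>?bs z\<close> \<open>almost_sub z z'\<close>] by blast
    show ?thesis
      using \<open>\<Psi> t z\<close> m unfolding \<Psi>_def by (cases t) (simp, metis)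
  qed
  define moves where "moves = positions \<times> {S. finite S \<and> S \<subseteq> D} \<times> D"
  have "countable moves"
    unfolding moves_def by (intro countable_SIGMA countable_positions countable_finite_subsets_D countable_D)
  then have "\<exists>x. ?bs x \<and> almost_sub x x1 \<and> (\<forall>t\<in>moves. \<Psi> t x \<longrightarrow> (\<forall>z. ?bs z \<longrightarrow> almost_sub z x \<longrightarrow> \<Psi> t z))"
    by (rule stabilise[OF _ x1(1)]) (rule \<Psi>_mono)
  then obtain x2 where x2: "?bs x2" "almost_sub x2 x1"
    and \<Psi>_stable: "\<And>t z. t \<in> moves \<Longrightarrow> \<Psi> t x2 \<Longrightarrow> ?bs z \<Longrightarrow> almost_sub z x2 \<Longrightarrow> \<Psi> t z"
    by blast
  \<comment> \<open>The number \<open>m\<close> makes \<open>Q s\<close> hereditary: I's moves in a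
    space almost contained in \<open>z\<close> are moves in \<open>z\<close> only from some point
    on.\<close>
  define Q where "Q s y \<longleftrightarrow> (\<exists>m. \<forall>F' v. I_move y s F' v \<longrightarrow> (\<forall>u\<in>F'. supp e u \<subseteq> {m..}) \<longrightarrow> \<Psi> (s, F', v) x2)"
    for s y
  have "\<exists>x. ?bs x \<and> almost_sub x x2 \<and> (\<forall>s\<in>G. Q s x)"
  proof (rule fusion)
    show "countable G"
      using countable_positions by (rule countable_subset[rotated]) (auto simp: G_def)
    show "?bs x2"
      by (fact x2(1))
  next
    fix s y z assume *: "?bs y" "?bs z" "almost_sub y z" "Q s z"
    obtain m where m: "\<And>v. v \<in> D \<Longrightarrow> v \<in> closed_span (range y) \<Longrightarrow> supp e v \<subseteq> {m..} \<Longrightarrow> v \<in> closed_span (range z)"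
      using almost_sub_beyond *(1,3) by blast
    obtain n where n: "\<And>F' v. I_move z s F' v \<Longrightarrow> \<forall>u\<in>F'. supp e u \<subseteq> {n..} \<Longrightarrow> \<Psi> (s, F', v) x2"
      using *(4) unfolding Q_def by blast
    have "\<Psi> (s, F', v) x2" if "I_move y s F' v" "\<forall>u\<in>F'. supp e u \<subseteq> {max m n..}" for F' v
    proof (rule n)
      have "\<forall>u\<in>F'. supp e u \<subseteq> {m..}"
        using that(2) by fastforce
      moreover have "F' \<subseteq> D \<inter> closed_span (range y)"
        using that(1) unfolding I_move_def by (cases s) auto
      ultimately have "F' \<subseteq> closed_span (range z)"
        using m by blast
      then show "I_move z s F' v"
        using that(1) unfolding I_move_def by (cases s) auto
      show "\<forall>u\<in>F'. supp e u \<subseteq> {n..}"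
        using that(2) by fastforce
    qed
    then show "Q s y"
      unfolding Q_def by blast
  next
    fix s z assume *: "s \<in> G" "?bs z" "almost_sub z x2"
    have z: "almost_sub z x1"
      using almost_sub_trans * x2 by blast
    have "\<Phi> s z"
      using \<Phi>_stable[OF _ _ *(2) z] *(1) unfolding G_def by blast
    then obtain y where y: "?bs y" "almost_sub y z" "II_wins C y z s"
      unfolding \<Phi>_def by blast
    \<comment> \<open>II's answer in \<open>z\<close> leads to a position where she still wins,
      hence to one in \<open>G\<close>; monotonicity carries the answer up to
      \<open>x2\<close>.\<close>
    have "\<Psi> (s, F', v) x2" if "I_move y s F' v" for F' v
    proof -
      have "\<exists>E' w. II_move C z n s v E' w \<and> next_pos s F' v E' w \<in> G" for n
      proof -
        obtain E' w where w: "II_move C z n s v E' w" "II_wins C y z (next_pos s F' v E' w)"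
          using y(3) \<open>I_move y s F' v\<close> by (cases rule: II_wins.cases) blast
        have "next_pos s F' v E' w \<in> positions"
          using next_pos_positions[OF _ that w(1)] *(1) unfolding G_def by blast
        moreover have "\<Phi> (next_pos s F' v E' w) x1"
          using \<Phi>_mono[OF *(2) x1(1) z] y(1,2) w(2) unfolding \<Phi>_def by blast
        ultimately show ?thesis
          using w(1) unfolding G_def by blast
      qed
      then have "\<Psi> (s, F', v) z"
        unfolding \<Psi>_def by simp
      then show ?thesis
        using \<Psi>_mono *(2,3) x2(1) by blast
    qed
    then show "\<exists>y. ?bs y \<and> almost_sub y z \<and> Q s y"
      using y unfolding Q_def by blast
  qed
  then obtain x where x: "?bs x" "almost_sub x x2" "\<And>s. s \<in> G \<Longrightarrow> Q s x"
    by blast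
  show thesis
  proof (rule that)
    show "?bs x"
      by (fact x(1))
    show "almost_sub x x0"
      using x x1 x2 almost_sub_trans by blast
    have "\<Phi> ({}, {}, [], []) x1"
      using copies[OF x1] unfolding \<Phi>_def .
    then show "({}, {}, [], []) \<in> G"
      by (simp add: G_def positions_def)
    fix s z assume *: "s \<in> G" "?bs z" "almost_sub z x"
    have z: "almost_sub z x2"
      using * x almost_sub_trans by blast
    obtain m where m: "\<And>F' v. I_move x s F' v \<Longrightarrow> \<forall>u\<in>F'. supp e u \<subseteq> {m..} \<Longrightarrow> \<Psi> (s, F', v) x2"
      using x(3)[OF *(1)] unfolding Q_def by blast
    have "\<exists>E' w. II_move C z 0 s v E' w \<and> next_pos s F' v E' w \<in> G"
      if F': "I_move x s F' v" "\<forall>u\<in>F'. supp e u \<subseteq> {m..}" for F' v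
    proof -
      obtain Fp Ep vs ws where s: "s = (Fp, Ep, vs, ws)"
        using prod_cases4 by blast
      have "(s, F', v) \<in> moves"
        using F'(1) *(1) initial_segment_D[of "vs @ [v]"] by (auto simp: I_move_def G_def moves_def s)
      then have "\<Psi> (s, F', v) z"
        using \<Psi>_stable m[OF F'] *(2) z by blast
      then show ?thesis
        unfolding \<Psi>_def by simp
    qed
    then show "\<exists>m. \<forall>F' v. I_move x s F' v \<longrightarrow> (\<forall>u\<in>F'. supp e u \<subseteq> {m..}) \<longrightarrow>
        (\<exists>E' w. II_move C z 0 s v E' w \<and> next_pos s F' v E' w \<in> G)"
      by blast
  qed
qed

text \<open>The games are composed: II's moves in the asymptotic game for \<open>y\<close> in
  \<open>x\<close>, made beyond the number \<open>m\<close> that the copying game requests, serve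
  there as I's moves. The copies in \<open>z\<close> are equivalent to \<open>y\<close> with
  constant \<open>C * C\<close>.\<close>

lemma embeds_if_survives:
  assumes y: "\<not> I_wins C y x []" and "C \<ge> 0" and G: "({}, {}, [], []) \<in> G"
    and move: "\<And>s. s \<in> G \<Longrightarrow>
      \<exists>m. \<forall>F' v. I_move x s F' v \<longrightarrow> (\<forall>u\<in>F'. supp e u \<subseteq> {m..}) \<longrightarrow>
        (\<exists>E' w. II_move C z 0 s v E' w \<and> next_pos s F' v E' w \<in> G)"
  shows "A_embeds A y (closed_span (range z))"
proof -
  define P where "P k = (\<lambda>(p, E, ws). II_survives C y x p \<and> length p = k \<and> length ws = k \<and>
      (pool p, E, map snd p, ws) \<in> G \<and> E \<subseteq> closed_span (range z) \<and> set ws \<subseteq> closed_span (range z) \<and>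
      initial_segment A ws \<and> equiv_upto C k ((!) ws) ((!) (map snd p)))" for k
  define R where "R = (\<lambda>(p :: ('a set \<times> 'a) list, E :: 'a set, ws) (p' :: ('a set \<times> 'a) list, E' :: 'a set, ws'). \<exists>w :: 'a. ws' = ws @ [w])"
  have "\<exists>f. \<forall>k. P k (f k) \<and> R (f k) (f (Suc k))"
  proof (rule dependent_nat_choice)
    have "initial_segment A []"
      using block_subspaceD(5)[OF block_subspace_basis] by (auto simp: initial_segment_def)
    then have "P 0 ([], {}, [])"
      using II_survives_Nil[OF y] G by (simp add: P_def pool_Nil equiv_upto_def)
    then show "\<exists>f. P 0 f"
      by blast
    fix f k assume "P k f"
    then obtain p E ws where f: "f = (p, E, ws)" and p: "II_survives C y x p" "length p = k" and ws: "length ws = k"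
      and s: "(pool p, E, map snd p, ws) \<in> G" and E: "E \<subseteq> closed_span (range z)" "set ws \<subseteq> closed_span (range z)"
      by (cases f) (auto simp: P_def)
    let ?s = "(pool p, E, map snd p, ws)"
    obtain m where m: "\<And>F' v. I_move x ?s F' v \<Longrightarrow> \<forall>u\<in>F'. supp e u \<subseteq> {m..} \<Longrightarrow>
        \<exists>E' w. II_move C z 0 ?s v E' w \<and> next_pos ?s F' v E' w \<in> G"
      using move[OF s] by blast
    obtain q where q: "legal C y x m p q" "II_survives C y x (p @ [q])"
      using II_survives_move[OF p(1)] by blast
    have "I_move x ?s (fst q) (snd q)"
      using q(1) by (simp add: legal_def I_move_def)
    moreover have "\<forall>u\<in>fst q. supp e u \<subseteq> {m..}"
      using q(1) by (simp add: legal_def)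
    ultimately obtain E' w where w: "II_move C z 0 ?s (snd q) E' w" "next_pos ?s (fst q) (snd q) E' w \<in> G"
      using m by blast
    have E': "E \<union> E' \<subseteq> closed_span (range z)"
      using w(1) E(1) by (auto simp: II_move_def)
    have "w \<in> closed_span (range z)"
      using w(1) span_subset_closed_span[OF E'] by (auto simp: II_move_def)
    then have "P (Suc k) (p @ [q], E \<union> E', ws @ [w])"
      using p ws q(2) w E(2) E' by (simp add: P_def II_move_def pool_append pool_single)
    moreover have "R f (p @ [q], E \<union> E', ws @ [w])"
      by (simp add: R_def f)
    ultimately show "\<exists>g. P (Suc k) g \<and> R f g"
      by blast
  qed
  then obtain f where f: "\<And>k. P k (f k)" "\<And>k. R (f k) (f (Suc k))"
    by blast
  define ws where "ws k = snd (snd (f k))" for k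
  define p where "p k = fst (f k)" for k
  define u where "u k = ws (Suc k) ! k" for k
  have P: "II_survives C y x (p k)" "length (p k) = k" "length (ws k) = k" "set (ws k) \<subseteq> closed_span (range z)"
    "initial_segment A (ws k)" "equiv_upto C k ((!) (ws k)) ((!) (map snd (p k)))" for k
    using f(1)[of k] by (auto simp: P_def p_def ws_def case_prod_unfold)
  have ws_Suc: "\<exists>w. ws (Suc k) = ws k @ [w]" for k
    using f(2)[of k] by (simp add: R_def ws_def case_prod_unfold)
  have ws_u: "ws k = map u [0..<k]" for k
  proof (induction k)
    case 0
    then show ?case
      using P(3)[of 0] by simp
  next
    case (Suc k)
    obtain w where w: "ws (Suc k) = ws k @ [w]"
      using ws_Suc by blast
    then have "u k = w"
      using P(3)[of k] by (simp add: u_def nth_append)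
    then show ?case
      using Suc w by simp
  qed
  have "u \<in> A"
    by (rule A_closed) (metis ws_u P(5))
  moreover have "u k \<in> closed_span (range z)" for k
    using P(4)[of "Suc k"] by (simp add: ws_u)
  \<comment> \<open>\<open>equivalent_seqs\<close> wants a constant of at least 1, whereas
    \<open>C\<close> may be smaller.\<close>
  moreover have "equiv_upto (max 1 (C * C)) k u y" for k
  proof -
    have "equiv_upto C k ((!) (map snd (p k))) y"
      using P(1,2)[of k] by (simp add: II_survives_def)
    then have "equiv_upto (C * C) k ((!) (ws k)) y"
      using equiv_upto_trans P(6) \<open>C \<ge> 0\<close> by blast
    then have "equiv_upto (C * C) k u y"
      by (rule equiv_upto_cong) (simp_all add: ws_u)
    then show ?thesis
      by (rule equiv_upto_mono_const) simp
  qed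
  then have "equiv_const (max 1 (C * C)) u y"
    by (simp add: equiv_const_iff_upto)
  ultimately show ?thesis
    unfolding A_embeds_def seqs_in_def equivalent_seqs_def
    by (intro bexI[of _ u]) (auto intro: exI[of _ "max 1 (C * C)"])
qed

section \<open>The dichotomy\<close>

lemma blocks_in_subspace:
  assumes "block_subspace e (blocks_in D x) y"
  shows "block_subspace e D y" "almost_sub y x"
  using assms by (auto simp: block_subspace_def block_seq_def blocks_in_def almost_sub_def)

text \<open>If \<open>Q t\<close> can be reached below every \<open>z\<close> for each
  \<open>t\<close>, fusion over \<open>t\<close> yields a tight space. Otherwise some
  \<open>t\<close> and \<open>x0\<close> are such that every space below \<open>x0\<close> contains
  a \<open>y\<close> for which I does not win, and the copying game applies.\<close>

theorem tight_or_minimal: "\<exists>x. block_subspace e D x \<and> (A_tight e D A x \<or> A_minimal e D A x)"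
proof -
  define Q where "Q t z \<longleftrightarrow> (\<forall>y. block_subspace e D y \<longrightarrow> almost_sub y z \<longrightarrow> I_wins (real t) y z [])" for t z
  have Q_mono: "Q t z" if "block_subspace e D z" "block_subspace e D z'" "almost_sub z z'" "Q t z'" for t z z'
    using that almost_sub_trans I_wins_almost_sub unfolding Q_def by meson
  show ?thesis
  proof (cases "\<forall>t z. block_subspace e D z \<longrightarrow> (\<exists>y. block_subspace e D y \<and> almost_sub y z \<and> Q t y)")
    case True
    then have "\<exists>x. block_subspace e D x \<and> almost_sub x e \<and> (\<forall>t\<in>UNIV. Q t x)"
      by (intro fusion) (use block_subspace_basis Q_mono in auto)
    then obtain x where x: "block_subspace e D x" "\<And>t. Q t x"
      by blast
    have "A_tight_in A y x" if "block_subspace e (blocks_in D x) y" for y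
      using tight_if_I_wins[OF x(1)] blocks_in_subspace[OF that] x(2) unfolding Q_def by blast
    then show ?thesis
      using x(1) unfolding A_tight_def by blast
  next
    case False
    then obtain t x0 where x0: "block_subspace e D x0"
      and notQ: "\<And>y. block_subspace e D y \<Longrightarrow> almost_sub y x0 \<Longrightarrow> \<not> Q t y"
      by blast
    have survives: "\<exists>y. block_subspace e D y \<and> almost_sub y z \<and> \<not> I_wins (real t) y z []"
      if "block_subspace e D z" "almost_sub z x0" for z
      using notQ[OF that] unfolding Q_def by blast
    have copies: "\<exists>y. block_subspace e D y \<and> almost_sub y z \<and> II_wins (real t) y z ({}, {}, [], [])"
      if z: "block_subspace e D z" "almost_sub z x0" for z
    proof -
      obtain y where y: "block_subspace e D y" "almost_sub y z" "\<not> I_wins (real t) y z []"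
        using survives[OF z] by blast
      have "II_wins (real t) y z ({}, pool [], [], [])"
        by (rule II_wins_if_survives[OF y(1) II_survives_Nil[OF y(3)]]) simp_all
      then show ?thesis
        using y(1,2) by (auto simp: pool_Nil)
    qed
    obtain x G where x: "block_subspace e D x" "almost_sub x x0" and G: "({}, {}, [], []) \<in> G"
      and move: "\<And>s z. s \<in> G \<Longrightarrow> block_subspace e D z \<Longrightarrow> almost_sub z x \<Longrightarrow>
      \<exists>m. \<forall>F' v. I_move x s F' v \<longrightarrow> (\<forall>u\<in>F'. supp e u \<subseteq> {m..}) \<longrightarrow>
        (\<exists>E' w. II_move t z 0 s v E' w \<and> next_pos s F' v E' w \<in> G)"
      using uniform_copying[OF x0 copies] by metis
    \<comment> \<open>This \<open>y\<close> embeds in every \<open>z\<close> almost contained in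
      \<open>x\<close>, in particular in each of its own block subspaces.\<close>
    obtain y where y: "block_subspace e D y" "almost_sub y x" "\<not> I_wins (real t) y x []"
      using survives x by blast
    have "A_embeds A y (closed_span (range z))" if z: "block_subspace e (blocks_in D y) z" for z
    proof (rule embeds_if_survives[OF y(3) _ G])
      have "block_subspace e D z" "almost_sub z x"
        using blocks_in_subspace[OF z] almost_sub_trans y by blast+
      then show "\<exists>m. \<forall>F' v. I_move x s F' v \<longrightarrow> (\<forall>u\<in>F'. supp e u \<subseteq> {m..}) \<longrightarrow>
        (\<exists>E' w. II_move t z 0 s v E' w \<and> next_pos s F' v E' w \<in> G)" if "s \<in> G" for s
        using move[OF that] by blast
    qed simp
    then show ?thesis
      using y(1) unfolding A_minimal_def by blast
  qed
qed

end

theorem theorem1p2: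
  fixes e :: "nat \<Rightarrow> 'a::banach"
    and F :: "real set"
    and D :: "'a set"
    and A :: "(nat \<Rightarrow> 'a) set"
  assumes "schauder_basis e" and "normalized e"
    and "scalar_field e F"
    and "admissible_system e F D A"
  shows "\<exists>x. block_subspace e D x \<and> (A_tight e D A x \<or> A_minimal e D A x)"
proof -
  interpret admissible_blocks e F D A
    by unfold_locales (fact assms)+
  show ?thesis
    by (rule tight_or_minimal)
qed

end
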